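(* Let $C_0>1$ be fixed. For every $0<\epsilon<1$ there is a constant $C$, depending on $\epsilon$, $C_0$ and $\Psi$ but not on $\mu$, $\Omega$, $f_1$, $f_2$, such that for every $\mu\in\mathbb Z$ with $2^{\mu-10}>C_0$, every $\Omega\in L^1(\mathbb S^1,u_1)$ with $\int_{\mathbb S^1}\Omega\,d\sigma=0$, and all Schwartz functions $f_1,f_2$ on $\mathbb R$, $$\Big\|\sup_{\gamma\in\mathbb Z}\big|\mathcal L_{\Omega,\mu}^{\gamma}(f_1,f_2)\big|\Big\|_{L^{\frac12,\infty}(\mathbb R)}\le C\,2^{\epsilon\mu}\,\|\Omega\|_{L^1(\mathbb S^1,u_1)}\,\|f_1\|_{L^1(\mathbb R)}\,\|f_2\|_{L^1(\mathbb R)}.$$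
   Context: $\mathbb S^1\subset\mathbb R^2$ is the unit circle with arc-length measure $\sigma$; $u_1(\theta_1,\theta_2):=|\theta_1-\theta_2|^{-1}$ for $(\theta_1,\theta_2)\in\mathbb S^1$, and $\|\Omega\|_{L^1(\mathbb S^1,u_1)}:=\int_{\mathbb S^1}|\Omega|\,u_1\,d\sigma$. The weak quasi-norm is $\|F\|_{L^{1/2,\infty}(\mathbb R)}:=\sup_{\lambda>0}\lambda\,|\{x\in\mathbb R:|F(x)|>\lambda\}|^{2}$. For $\Omega\in L^1(\mathbb S^1)$ let $K(\vec y):=\Omega(\vec y/|\vec y|)\,|\vec y|^{-2}$, $\vec y=(y_1,y_2)\in\mathbb R^2\setminus\{0\}$. The fixed constant $C_0>1$ enters only as a threshold for $\mu$ (in the paper it is the support radius of a fixed family of compactly supported wavelets). Fix a Schwartz function $\Psi$ on $\mathbb R^2$ whose Fourier transform satisfies $\mathrm{supp}\,\widehat\Psi\subset\{\vec\xi\in\mathbb R^2:\frac12\le|\vec\xi|\le2\}$ and $\sum_{k\in\mathbb Z}\widehat{\Psi_k}(\vec\xi)=1$ for $\vec\xi\ne0$, where $\Psi_k:=2^{2k}\Psi(2^k\cdot)$, so $\widehat{\Psi_k}(\vec\xi)=\widehat\Psi(2^{-k}\vec\xi)$. Put $\widehat\Phi(\vec y):=1-\sum_{\gamma\ge1}\widehat\Psi(2^{-\gamma}\vec y)$, which is supported in $\{|\vec y|\le2\}$ and equals $1$ for $|\vec y|\le1$. For $\gamma,\mu\in\mathbb Z$ set $$K^*_\gamma(\vec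 y):=K(\vec y)\,\widehat\Phi(2^{-\gamma}\vec y)\,\chi_{\{2^\gamma<|\vec y|\le2^{\gamma+1}\}}(\vec y),$$ $$\mathcal L_{\Omega,\mu}^{\gamma}(f_1,f_2)(x):=\int_{\mathbb R^2}\big(\Psi_{\mu-\gamma}*K^*_\gamma\big)(\vec y)\,f_1(x-y_1)\,f_2(x-y_2)\,d\vec y,\qquad x\in\mathbb R.$$ *)

theory Defs
  imports "HOL-Analysis.Analysis"
begin

text \<open>Functions are complex-valued, \<open>\<real>\<^sup>2\<close> is \<^typ>\<open>real \<times> real\<close> (whose library norm is the Euclidean
  one), and integrals are with respect to the completed Lebesgue measure, so that a merely
  Lebesgue-measurable \<open>\<Omega>\<close> is allowed.\<close>

subsection \<open>Schwartz functions and the Fourier transform\<close>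

primrec iterated_partial :: "'a list \<Rightarrow> ('a::euclidean_space \<Rightarrow> complex) \<Rightarrow> 'a \<Rightarrow> complex" where
  "iterated_partial [] f = f"
| "iterated_partial (v # vs) f = (\<lambda>x. frechet_derivative (iterated_partial vs f) (at x) v)"

text \<open>A list of basis vectors plays the role of a multi-index. Differentiability of all iterated
  partial derivatives is smoothness, since each of them is then in particular continuous.\<close>

definition schwartz :: "('a::euclidean_space \<Rightarrow> complex) \<Rightarrow> bool" where
  "schwartz f \<longleftrightarrow> (\<forall>vs. set vs \<subseteq> Basis \<longrightarrow>
     (\<forall>x. iterated_partial vs f differentiable (at x)) \<and>
     (\<forall>k::nat. \<exists>B. \<forall>x. norm x ^ k * norm (iterated_partial vs f x) \<le> B))"

definition fourier :: "('a::euclidean_space \<Rightarrow> complex) \<Rightarrow> 'a \<Rightarrow> complex" where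
  "fourier f \<xi> = (LINT x|lebesgue. cis (- 2 * pi * (x \<bullet> \<xi>)) * f x)"

definition convolution :: "('a::euclidean_space \<Rightarrow> complex) \<Rightarrow> ('a \<Rightarrow> complex) \<Rightarrow> 'a \<Rightarrow> complex" where
  "convolution f g y = (LINT z|lebesgue. f (y - z) * g z)"

definition dyadic_dilation :: "(real \<times> real \<Rightarrow> complex) \<Rightarrow> int \<Rightarrow> real \<times> real \<Rightarrow> complex" where
  "dyadic_dilation \<Psi> k y = of_real (2 powi (2 * k)) * \<Psi> ((2 powi k) *\<^sub>R y)"

definition Phi_hat :: "(real \<times> real \<Rightarrow> complex) \<Rightarrow> real \<times> real \<Rightarrow> complex" where
  "Phi_hat \<Psi> y = 1 - (\<Sum>\<^sub>\<infinity>\<gamma>\<in>{1::int..}. fourier \<Psi> ((2 powi (- \<gamma>)) *\<^sub>R y))"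

subsection \<open>Norms\<close>

definition arc_length :: "(real \<times> real) measure" where
  "arc_length = completion (distr (restrict_space lborel {0..<2 * pi})
     (restrict_space borel (sphere 0 1)) (\<lambda>t. (cos t, sin t)))"

text \<open>The weight is \<open>\<infinity>\<close> on the diagonal, as \<open>inverse 0 = \<infinity>\<close> in \<^typ>\<open>ennreal\<close>.\<close>

definition u1 :: "real \<times> real \<Rightarrow> ennreal" where
  "u1 \<theta> = inverse (ennreal \<bar>fst \<theta> - snd \<theta>\<bar>)"

definition L1_u1_norm :: "(real \<times> real \<Rightarrow> complex) \<Rightarrow> ennreal" where
  "L1_u1_norm \<Omega> = (\<integral>\<^sup>+ \<theta>. ennreal (norm (\<Omega> \<theta>)) * u1 \<theta> \<partial>arc_length)"

definition L1_u1 :: "(real \<times> real \<Rightarrow> complex) set" where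
  "L1_u1 = {\<Omega>. \<Omega> \<in> borel_measurable arc_length \<and> L1_u1_norm \<Omega> < \<infinity>}"

definition L1_norm :: "(real \<Rightarrow> complex) \<Rightarrow> ennreal" where
  "L1_norm f = (\<integral>\<^sup>+ x. ennreal (norm (f x)) \<partial>lebesgue)"

text \<open>The argument is the modulus of the function, which may be \<open>\<infinity>\<close> for a supremum.\<close>

definition weak_L_half_norm :: "(real \<Rightarrow> ennreal) \<Rightarrow> ennreal" where
  "weak_L_half_norm F =
     (SUP l\<in>{0::real<..}. ennreal l * (emeasure lebesgue {x. F x > ennreal l})\<^sup>2)"

subsection \<open>The bilinear operators\<close>

definition rough_kernel :: "(real \<times> real \<Rightarrow> complex) \<Rightarrow> real \<times> real \<Rightarrow> complex" where
  "rough_kernel \<Omega> y = \<Omega> (y /\<^sub>R norm y) / of_real ((norm y)\<^sup>2)"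

definition K_star ::
  "(real \<times> real \<Rightarrow> complex) \<Rightarrow> (real \<times> real \<Rightarrow> complex) \<Rightarrow> int \<Rightarrow> real \<times> real \<Rightarrow> complex" where
  "K_star \<Psi> \<Omega> \<gamma> y = rough_kernel \<Omega> y * Phi_hat \<Psi> ((2 powi (- \<gamma>)) *\<^sub>R y) *
     indicator {y. 2 powi \<gamma> < norm y \<and> norm y \<le> 2 powi (\<gamma> + 1)} y"

definition L_op ::
  "(real \<times> real \<Rightarrow> complex) \<Rightarrow> (real \<times> real \<Rightarrow> complex) \<Rightarrow> int \<Rightarrow> int \<Rightarrow>
   (real \<Rightarrow> complex) \<Rightarrow> (real \<Rightarrow> complex) \<Rightarrow> real \<Rightarrow> complex" where
  "L_op \<Psi> \<Omega> \<mu> \<gamma> f1 f2 x =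
     (LINT y|lebesgue. convolution (dyadic_dilation \<Psi> (\<mu> - \<gamma>)) (K_star \<Psi> \<Omega> \<gamma>) y *
        f1 (x - fst y) * f2 (x - snd y))"

end

theory Submission
  imports Defs
begin

text \<open>The kernel is used only through two properties of a Borel majorant \<open>K\<close> of
  \<open>\<bar>K_star\<bar>\<close> at scale \<open>\<gamma>\<close>: it lives on \<open>\<bar>z\<bar> \<le> 2\<^sup>\<gamma>\<^sup>+\<^sup>1\<close>, and its integral over every line
  \<open>{(s, s + d)}\<close> with \<open>d \<noteq> 0\<close> is at most \<open>2\<^sup>-\<^sup>\<gamma>\<close> times the weighted norm of \<open>\<Omega>\<close>. The convolution
  with \<open>\<Psi>\<close> is absorbed by averaging \<open>\<bar>f1\<bar>\<close> and \<open>\<bar>f2\<bar>\<close> at scale \<open>2\<^sup>\<gamma>\<^sup>-\<^sup>\<mu>\<close>, so that everything becomes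
  positive.

  Normalise the norms to one, fix a level \<open>l\<close> and let \<open>\<alpha>\<close> be a small multiple of \<open>sqrt l\<close>. Outside
  the set where a dyadic maximal function exceeds \<open>\<alpha> / 2\<close>, the averages at scale \<open>2\<^sup>\<gamma>\<^sup>-\<^sup>\<mu>\<close> that matter
  at scale \<open>\<gamma>\<close> are bounded by \<open>8 \<alpha>\<close> plus those of the part of \<open>f\<close> carried by the points whose
  largest scale with average above \<open>\<alpha>\<close> lies between \<open>\<gamma> - \<mu>\<close> and \<open>\<gamma> + 1\<close>. A point is of this kind for
  only \<open>\<mu> + 2\<close> values of \<open>\<gamma>\<close>, so single-scale estimates can be summed over \<open>\<gamma>\<close>, with a loss
  polynomial in \<open>\<mu>\<close>.\<close>

subsection \<open>Dyadic averages and the maximal function\<close>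

text \<open>When \<open>x\<close> varies, the point \<open>(x - y1, x - y2)\<close> moves along a
  line parallel to the diagonal, so the integral of a bilinear form over \<open>x\<close> sees the
  kernel only through its integrals over the lines \<open>{(s, s + d)}\<close>. Arc length on such a
  line carries a factor \<open>\<bar>d\<bar>\<close>; dividing it out is what the weight
  \<open>u1\<close> pays for.

  The obstacle is the supremum over infinitely many scales in a quasi-norm of exponent 1/2:
  single-scale bounds by the product of the full norms cannot be added. With both norms normalised
  to one, the single-scale bound is therefore written additively: the set where the form exceeds
  \<open>l\<close> has measure at most a constant over \<open>sqrt l\<close> times the sum of the
  two masses. Being linear in the masses, it can be summed once each scale receives only a portion
  of the functions and the portions overlap boundedly often. The stopping scales supply these
  portions. The measure then grows like \<open>\<mu> + 2\<close>, its square enters the quasi-norm,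
  and \<open>2 powr (\<epsilon> * \<mu>)\<close> dominates that square up to a constant.\<close>

lemma emeasure_UN_le_nn_integral:
  assumes "countable I" and [measurable]: "\<And>i. i \<in> I \<Longrightarrow> A i \<in> sets M"
  shows "emeasure M (\<Union>i\<in>I. A i) \<le> (\<integral>\<^sup>+ i. emeasure M (A i) \<partial>count_space I)"
proof -
  have [measurable]: "(\<Union>i\<in>I. A i) \<in> sets M"
    using assms by (intro sets.countable_UN') auto
  have "emeasure M (\<Union>i\<in>I. A i) = (\<integral>\<^sup>+ x. indicator (\<Union>i\<in>I. A i) x \<partial>M)"
    by simp
  also have "\<dots> \<le> (\<integral>\<^sup>+ x. \<integral>\<^sup>+ i. indicator (A i) x \<partial>count_space I \<partial>M)"
  proof (rule nn_integral_mono)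
    fix x
    show "(indicator (\<Union>i\<in>I. A i) x :: ennreal) \<le> (\<integral>\<^sup>+ i. indicator (A i) x \<partial>count_space I)"
    proof (cases "x \<in> (\<Union>i\<in>I. A i)")
      case True
      then obtain i where i: "i \<in> I" "x \<in> A i" by auto
      then have "(1::ennreal) = indicator (A i) x" by simp
      also have "\<dots> \<le> (\<integral>\<^sup>+ i. indicator (A i) x \<partial>count_space I)"
        using i(1) by (rule nn_integral_ge_point)
      finally show ?thesis using True by simp
    qed simp
  qed
  also have "\<dots> = (\<integral>\<^sup>+ i. \<integral>\<^sup>+ x. indicator (A i) x \<partial>M \<partial>count_space I)"
    using assms by (intro nn_integral_count_space_nn_integral) auto
  also have "\<dots> = (\<integral>\<^sup>+ i. emeasure M (A i) \<partial>count_space I)"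
    by (intro nn_integral_cong) auto
  finally show ?thesis .
qed

lemma markov_ennreal:
  fixes c :: real
  assumes [measurable]: "g \<in> borel_measurable M" and c: "c > 0"
  shows "emeasure M {x \<in> space M. g x > ennreal c} \<le> ennreal (1 / c) * (\<integral>\<^sup>+ x. g x \<partial>M)"
proof -
  have "emeasure M {x \<in> space M. g x > ennreal c} \<le> emeasure M {x \<in> space M. 1 \<le> ennreal (1 / c) * g x}"
  proof (rule emeasure_mono)
    show "{x \<in> space M. g x > ennreal c} \<subseteq> {x \<in> space M. 1 \<le> ennreal (1 / c) * g x}"
    proof safe
      fix x assume "ennreal c < g x"
      then have "ennreal (1 / c) * ennreal c \<le> ennreal (1 / c) * g x"
        by (intro mult_left_mono) auto
      then show "1 \<le> ennreal (1 / c) * g x"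
        using c by (simp flip: ennreal_mult')
    qed
  qed measurable
  also have "\<dots> \<le> ennreal (1 / c) * (\<integral>\<^sup>+ x. g x * indicator (space M) x \<partial>M)"
    by (rule nn_integral_Markov_inequality) auto
  also have "(\<integral>\<^sup>+ x. g x * indicator (space M) x \<partial>M) = (\<integral>\<^sup>+ x. g x \<partial>M)"
    by (intro nn_integral_cong) simp
  finally show ?thesis .
qed

lemma emeasure_lborel_cball_real: "r \<ge> 0 \<Longrightarrow> emeasure lborel (cball (x::real) r) = ennreal (2 * r)"
  by (simp add: cball_eq_atLeastAtMost)

text \<open>Twice the mean over the centred interval of radius \<open>2 powi j\<close>: dividing by
  the radius instead of the length keeps all constants powers of two.\<close>

definition avg :: "int \<Rightarrow> (real \<Rightarrow> ennreal) \<Rightarrow> real \<Rightarrow> ennreal" where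
  "avg j f u = ennreal (2 powi (-j)) * (\<integral>\<^sup>+ t. f t * indicator (cball u (2 powi j)) t \<partial>lborel)"

lemma indicator_cball_measurable [measurable]:
  fixes g h :: "'a \<Rightarrow> 'b::euclidean_space"
  assumes [measurable]: "g \<in> borel_measurable M" "h \<in> borel_measurable M"
  shows "(\<lambda>x. indicator (cball (g x) r) (h x) :: ennreal) \<in> borel_measurable M"
proof -
  have "(\<lambda>x. indicator (cball (g x) r) (h x) :: ennreal) = (\<lambda>x. if dist (g x) (h x) \<le> r then 1 else 0)"
    by (auto simp: fun_eq_iff split: split_indicator)
  then show ?thesis by simp
qed

lemma cball_integral_measurable [measurable]:
  assumes [measurable]: "f \<in> borel_measurable borel"
  shows "(\<lambda>u. \<integral>\<^sup>+ t. f t * indicator (cball u r) t \<partial>lborel) \<in> borel_measurable (borel :: real measure)"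
proof -
  have "(\<lambda>(u, t). f t * indicator (cball u r) t) \<in> borel_measurable (borel \<Otimes>\<^sub>M lborel)"
    unfolding case_prod_unfold by measurable
  then show ?thesis
    by (rule lborel.borel_measurable_nn_integral)
qed

lemma avg_measurable [measurable]:
  assumes [measurable]: "f \<in> borel_measurable borel"
  shows "avg j f \<in> borel_measurable borel"
  unfolding avg_def by measurable

lemma cball_integral_eq_avg:
  "(\<integral>\<^sup>+ t. f t * indicator (cball u (2 powi j)) t \<partial>lborel) = ennreal (2 powi j) * avg j f u"
proof -
  have "ennreal (2 powi j) * ennreal (2 powi (-j)) = 1"
    by (simp flip: ennreal_mult add: power_int_minus)
  then show ?thesis unfolding avg_def mult.assoc[symmetric] by simp
qed

lemma avg_le_avg:
  assumes "cball u (2 powi j) \<subseteq> cball v (2 powi i)"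
  shows "avg j f u \<le> ennreal (2 powi (i - j)) * avg i f v"
proof -
  have e: "(2::real) powi (- j) = 2 powi (i - j) * 2 powi (- i)"
    by (simp flip: power_int_add)
  have "avg j f u \<le> ennreal (2 powi (-j)) * (\<integral>\<^sup>+ t. f t * indicator (cball v (2 powi i)) t \<partial>lborel)"
    unfolding avg_def using assms
    by (intro mult_left_mono nn_integral_mono) (auto split: split_indicator)
  also have "\<dots> = ennreal (2 powi (i - j)) * avg i f v"
    unfolding avg_def e by (simp add: ennreal_mult mult.assoc)
  finally show ?thesis .
qed

lemma nn_integral_avg:
  assumes [measurable]: "f \<in> borel_measurable borel"
  shows "(\<integral>\<^sup>+ u. avg j f u \<partial>lborel) = 2 * (\<integral>\<^sup>+ t. f t \<partial>lborel)"
proof -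
  have [measurable]: "(\<lambda>(u, t). f t * indicator (cball u r) t) \<in> borel_measurable (borel \<Otimes>\<^sub>M borel)" for r :: real
    unfolding case_prod_unfold by measurable
  have [measurable]: "(\<lambda>(u, t). f t * indicator (cball u r) t) \<in> borel_measurable (lborel \<Otimes>\<^sub>M lborel)" for r :: real
    using measurable_lborel1 by measurable
  have "(\<integral>\<^sup>+ u. \<integral>\<^sup>+ t. f t * indicator (cball u (2 powi j)) t \<partial>lborel \<partial>lborel)
      = (\<integral>\<^sup>+ t. \<integral>\<^sup>+ u. f t * indicator (cball u (2 powi j)) t \<partial>lborel \<partial>lborel)"
    by (rule lborel_pair.Fubini') measurable
  also have "\<dots> = (\<integral>\<^sup>+ t. \<integral>\<^sup>+ u. f t * indicator (cball t (2 powi j)) u \<partial>lborel \<partial>lborel)"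
    by (intro nn_integral_cong) (auto split: split_indicator simp: dist_commute)
  also have "\<dots> = (\<integral>\<^sup>+ t. f t * ennreal (2 * 2 powi j) \<partial>lborel)"
    by (intro nn_integral_cong, subst nn_integral_cmult)
      (auto simp: emeasure_lborel_cball_real)
  also have "\<dots> = (\<integral>\<^sup>+ t. f t \<partial>lborel) * ennreal (2 * 2 powi j)"
    by (rule nn_integral_multc) measurable
  finally show ?thesis
    unfolding avg_def
    by (subst nn_integral_cmult) (auto simp: mult.assoc mult.left_commute mult.commute[of _ 2] power_int_minus simp flip: ennreal_mult)
qed

text \<open>The total mass is at most one, so a large average forces a short interval. This supplies
  the bounded radii that the Vitali covering argument requires.\<close>

lemma powi_le_of_avg_gt:
  assumes "(\<integral>\<^sup>+ t. f t \<partial>lborel) \<le> 1" "\<beta> > 0" "avg j f x > ennreal \<beta>"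
  shows "2 powi j \<le> 1 / \<beta>"
proof -
  have "(\<integral>\<^sup>+ t. f t * indicator (cball x (2 powi j)) t \<partial>lborel) \<le> (\<integral>\<^sup>+ t. f t \<partial>lborel)"
    by (intro nn_integral_mono) (auto split: split_indicator)
  with assms(1) have "(\<integral>\<^sup>+ t. f t * indicator (cball x (2 powi j)) t \<partial>lborel) \<le> 1" by simp
  then have "avg j f x \<le> ennreal (2 powi (-j)) * 1"
    unfolding avg_def by (intro mult_left_mono) auto
  with assms(3) have "ennreal \<beta> \<le> ennreal (2 powi (-j))"
    by (metis less_imp_le mult.right_neutral order_trans)
  then have "\<beta> \<le> 2 powi (-j)"
    by (subst (asm) ennreal_le_iff) auto
  then show ?thesis using assms(2) by (simp add: power_int_minus field_simps)
qed

text \<open>Vitali selects disjoint intervals whose fivefold enlargements still cover. An enlarged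
  interval has length \<open>10 * r\<close>, while the selected one carries mass more than
  \<open>\<beta> * r\<close>; disjointness bounds the sum of these masses by one.\<close>

lemma weak_type_maximal:
  assumes [measurable]: "f \<in> borel_measurable borel" and f1: "(\<integral>\<^sup>+ t. f t \<partial>lborel) \<le> 1" and b: "\<beta> > 0"
  shows "emeasure lborel {x. \<exists>j. avg j f x > ennreal \<beta>} \<le> ennreal (10 / \<beta>)"
proof -
  define K where "K = {(x, j). avg j f x > ennreal \<beta>}"
  define r where "r = (\<lambda>(x::real, j::int). (2::real) powi j)"
  have r: "0 < r i \<and> r i \<le> 1 / \<beta>" if "i \<in> K" for i
    using that powi_le_of_avg_gt[OF f1 b] by (auto simp: K_def r_def)
  have S: "{x. \<exists>j. avg j f x > ennreal \<beta>} \<subseteq> (\<Union>i\<in>K. cball (fst i) (r i))"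
    by (force simp: K_def r_def)
  obtain C where C: "countable C" "C \<subseteq> K"
     "pairwise (\<lambda>i j. disjnt (cball (fst i) (r i)) (cball (fst j) (r j))) C"
     "{x. \<exists>j. avg j f x > ennreal \<beta>} \<subseteq> (\<Union>i\<in>C. cball (fst i) (5 * r i))"
    using Vitali_covering_lemma_cballs[OF S r] by blast
  define N where "N = density lborel f"
  have "emeasure lborel {x. \<exists>j. avg j f x > ennreal \<beta>} \<le> emeasure lborel (\<Union>i\<in>C. cball (fst i) (5 * r i))"
    using C by (intro emeasure_mono sets.countable_UN') auto
  also have "\<dots> \<le> (\<integral>\<^sup>+ i. emeasure lborel (cball (fst i) (5 * r i)) \<partial>count_space C)"
    using C by (intro emeasure_UN_le_nn_integral) auto
  also have "\<dots> \<le> (\<integral>\<^sup>+ i. ennreal (10 / \<beta>) * emeasure N (cball (fst i) (r i)) \<partial>count_space C)"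
  proof (intro nn_integral_mono)
    fix i assume "i \<in> space (count_space C)"
    then have "i \<in> K" using C by auto
    then have a: "ennreal \<beta> < avg (snd i) f (fst i)" and ri: "r i = 2 powi (snd i)" "r i > 0"
      by (auto simp: K_def r_def)
    have "emeasure lborel (cball (fst i) (5 * r i)) = ennreal (10 * r i)"
      using ri by (subst emeasure_lborel_cball_real) (auto simp del: zero_less_power_int)
    also have "\<dots> = ennreal (10 / \<beta>) * (ennreal (2 powi (snd i)) * ennreal \<beta>)"
      using ri b by (simp flip: ennreal_mult)
    also have "\<dots> \<le> ennreal (10 / \<beta>) * (ennreal (2 powi (snd i)) * avg (snd i) f (fst i))"
      using a by (intro mult_left_mono) auto
    also have "ennreal (2 powi (snd i)) * avg (snd i) f (fst i) = emeasure N (cball (fst i) (r i))"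
      unfolding N_def by (subst emeasure_density) (auto simp: cball_integral_eq_avg ri)
    finally show "emeasure lborel (cball (fst i) (5 * r i)) \<le> ennreal (10 / \<beta>) * emeasure N (cball (fst i) (r i))" .
  qed
  also have "\<dots> = ennreal (10 / \<beta>) * (\<integral>\<^sup>+ i. emeasure N (cball (fst i) (r i)) \<partial>count_space C)"
    by (rule nn_integral_cmult) auto
  also have "(\<integral>\<^sup>+ i. emeasure N (cball (fst i) (r i)) \<partial>count_space C) = emeasure N (\<Union>i\<in>C. cball (fst i) (r i))"
    using C(1,3) by (intro emeasure_UN_countable[symmetric])
      (auto simp: N_def disjoint_family_on_def pairwise_def disjnt_def)
  also have "\<dots> \<le> emeasure N (space N)" by (rule emeasure_space)
  also have "\<dots> \<le> 1" using f1 by (simp add: N_def emeasure_density)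
  finally show ?thesis by (simp add: mult_left_mono)
qed

subsection \<open>Dyadic smoothing\<close>

text \<open>Comparable to the dilated profile \<open>2^-k / (1 + (t / 2^k)^2)\<close>, but written
  as a superposition of normalised indicators, so that convolving with it yields a weighted sum of
  the averages \<open>avg\<close>.\<close>

definition bump :: "int \<Rightarrow> real \<Rightarrow> ennreal" where
  "bump k t = (\<Sum>m. ennreal ((1/2) ^ m) * (ennreal (2 powi (- (k + int m))) * indicator (cball 0 (2 powi (k + int m))) t))"

definition smooth :: "int \<Rightarrow> (real \<Rightarrow> ennreal) \<Rightarrow> real \<Rightarrow> ennreal" where
  "smooth k f u = (\<integral>\<^sup>+ t. bump k (u - t) * f t \<partial>lborel)"

lemma bump_measurable [measurable]: "bump k \<in> borel_measurable borel"
  unfolding bump_def by measurable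

lemma smooth_eq_suminf:
  assumes [measurable]: "f \<in> borel_measurable borel"
  shows "smooth k f u = (\<Sum>m. ennreal ((1/2) ^ m) * avg (k + int m) f u)"
proof -
  have "smooth k f u = (\<integral>\<^sup>+ t. (\<Sum>m. ennreal ((1/2) ^ m) * (ennreal (2 powi (- (k + int m))) *
      (f t * indicator (cball u (2 powi (k + int m))) t))) \<partial>lborel)"
    unfolding smooth_def bump_def
    by (intro nn_integral_cong, subst ennreal_suminf_multc[symmetric], intro suminf_cong)
      (auto split: split_indicator simp: dist_real_def mult.assoc)
  also have "\<dots> = (\<Sum>m. \<integral>\<^sup>+ t. ennreal ((1/2) ^ m) * (ennreal (2 powi (- (k + int m))) *
      (f t * indicator (cball u (2 powi (k + int m))) t)) \<partial>lborel)"
    by (rule nn_integral_suminf) measurable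
  also have "\<dots> = (\<Sum>m. ennreal ((1/2) ^ m) * avg (k + int m) f u)"
    unfolding avg_def by (intro suminf_cong) (simp add: nn_integral_cmult)
  finally show ?thesis .
qed

lemma smooth_measurable [measurable]:
  assumes [measurable]: "f \<in> borel_measurable borel"
  shows "smooth k f \<in> borel_measurable borel"
proof -
  have "smooth k f = (\<lambda>u. \<Sum>m. ennreal ((1/2) ^ m) * avg (k + int m) f u)"
    by (intro ext smooth_eq_suminf) measurable
  then show ?thesis by simp
qed

lemma suminf_half_ennreal: "(\<Sum>m. ennreal ((1/2) ^ m)) = 2"
proof -
  have "(\<lambda>m. (1/2::real) ^ m) sums 2"
    using geometric_sums[of "1/2::real"] by simp
  then have "(\<Sum>m. ennreal ((1/2) ^ m)) = ennreal 2"
    by (intro suminf_ennreal_eq) auto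
  then show ?thesis by simp
qed

lemma nn_integral_smooth:
  assumes [measurable]: "f \<in> borel_measurable borel"
  shows "(\<integral>\<^sup>+ u. smooth k f u \<partial>lborel) = 4 * (\<integral>\<^sup>+ t. f t \<partial>lborel)"
proof -
  have "(\<integral>\<^sup>+ u. smooth k f u \<partial>lborel) = (\<Sum>m. \<integral>\<^sup>+ u. ennreal ((1/2) ^ m) * avg (k + int m) f u \<partial>lborel)"
    unfolding smooth_eq_suminf[OF assms] by (rule nn_integral_suminf) measurable
  also have "\<dots> = (\<Sum>m. ennreal ((1/2) ^ m) * (2 * (\<integral>\<^sup>+ t. f t \<partial>lborel)))"
    by (intro suminf_cong) (simp add: nn_integral_cmult nn_integral_avg)
  also have "\<dots> = 2 * (2 * (\<integral>\<^sup>+ t. f t \<partial>lborel))"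
    by (simp only: ennreal_suminf_multc suminf_half_ennreal)
  finally show ?thesis by (simp flip: mult.assoc)
qed

lemma nn_integral_bump: "(\<integral>\<^sup>+ t. bump k t \<partial>lborel) = 4"
proof -
  have "(\<integral>\<^sup>+ t. bump k t \<partial>lborel) = (\<Sum>m. \<integral>\<^sup>+ t. ennreal ((1/2) ^ m) * (ennreal (2 powi (- (k + int m))) *
      indicator (cball 0 (2 powi (k + int m))) (t::real)) \<partial>lborel)"
    unfolding bump_def by (rule nn_integral_suminf) measurable
  also have "\<dots> = (\<Sum>m. ennreal ((1/2) ^ m) * 2)"
  proof (intro suminf_cong)
    fix m
    have "ennreal (2 powi (- j)) * ennreal (2 * 2 powi j) = 2" for j :: int
    proof -
      have "(2::real) powi (- j) * (2 * 2 powi j) = 2" by (simp add: power_int_minus)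
      then have "ennreal (2 powi (- j) * (2 * 2 powi j)) = 2" by (simp only: ennreal_numeral)
      then show ?thesis by (subst (asm) ennreal_mult) simp_all
    qed
    note two = this
    have "(\<integral>\<^sup>+ t. ennreal ((1/2) ^ m) * (ennreal (2 powi (- (k + int m))) *
      indicator (cball 0 (2 powi (k + int m))) (t::real)) \<partial>lborel)
      = ennreal ((1/2) ^ m) * (ennreal (2 powi (- (k + int m))) * ennreal (2 * 2 powi (k + int m)))"
      by (subst nn_integral_cmult; (subst nn_integral_cmult_indicator)?) (auto simp: emeasure_lborel_cball_real)
    then show "(\<integral>\<^sup>+ t. ennreal ((1/2) ^ m) * (ennreal (2 powi (- (k + int m))) *
      indicator (cball 0 (2 powi (k + int m))) (t::real)) \<partial>lborel) = ennreal ((1/2) ^ m) * 2"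
      by (simp only: two)
  qed
  also have "\<dots> = 2 * 2" by (simp only: ennreal_suminf_multc suminf_half_ennreal)
  finally show ?thesis by simp
qed

text \<open>The dyadic radii turn the decay of order two into the weights \<open>2\<^sup>-\<^sup>m\<close>.\<close>

lemma bump_ge: "ennreal (1 / (1 + t\<^sup>2)) \<le> 4 * bump 0 t"
proof -
  obtain m :: nat where m: "\<bar>t\<bar> \<le> 2 ^ m" "2 ^ m \<le> max 1 (2 * \<bar>t\<bar>)"
  proof -
    define m where "m = (LEAST m::nat. \<bar>t\<bar> \<le> 2 ^ m)"
    obtain n :: nat where "\<bar>t\<bar> \<le> 2 ^ n"
      using real_arch_pow[of 2 "\<bar>t\<bar>"] by (auto intro: less_imp_le)
    then have 1: "\<bar>t\<bar> \<le> 2 ^ m" unfolding m_def by (rule LeastI)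
    have 2: "2 ^ m \<le> max 1 (2 * \<bar>t\<bar>)"
    proof (cases m)
      case (Suc l)
      then have "\<not> \<bar>t\<bar> \<le> 2 ^ l" using not_less_Least[of l "\<lambda>m. \<bar>t\<bar> \<le> 2 ^ m"] unfolding m_def by auto
      then show ?thesis using Suc by auto
    qed simp
    show thesis using that[OF 1 2] .
  qed
  \<comment> \<open>By minimality of \<open>m\<close> the radius exceeds
    \<open>\<bar>t\<bar>\<close> by at most a factor two, unless it is 1; hence the single term of
    index \<open>m\<close> already dominates the profile.\<close>
  have "(2 ^ m)\<^sup>2 \<le> 4 * (1 + t\<^sup>2)"
  proof (cases "2 ^ m \<le> (1::real)")
    case True
    then have "(2 ^ m)\<^sup>2 \<le> (1::real)" by (simp add: power_le_one)
    also have "\<dots> \<le> 4 * (1 + t\<^sup>2)" by simp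
    finally show ?thesis .
  next
    case False
    then have "2 ^ m \<le> 2 * \<bar>t\<bar>" using m(2) by (auto simp: max_def split: if_splits)
    then have "(2 ^ m)\<^sup>2 \<le> (2 * \<bar>t\<bar>)\<^sup>2" by (intro power_mono) auto
    then show ?thesis by (simp add: power_mult_distrib)
  qed
  then have "1 / (1 + t\<^sup>2) \<le> 4 * ((1/2) ^ m * (1/2) ^ m)"
    by (simp add: field_simps power2_eq_square add_pos_nonneg)
  then have "ennreal (1 / (1 + t\<^sup>2)) \<le> ennreal (4 * ((1/2) ^ m * (1/2) ^ m))"
    by (rule ennreal_leI)
  also have "\<dots> = 4 * (ennreal ((1/2) ^ m) * ennreal ((1/2) ^ m))"
    by (subst ennreal_mult, simp, simp, subst ennreal_mult) auto
  also have "\<dots> = 4 * (ennreal ((1/2) ^ m) * (ennreal (2 powi (- (0 + int m))) * indicator (cball 0 (2 powi (0 + int m))) t))"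
    using m(1) by (simp add: power_int_minus power_one_over inverse_eq_divide)
  also have "\<dots> \<le> 4 * bump 0 t"
    unfolding bump_def
    using sum_le_suminf[of "\<lambda>m. ennreal ((1/2) ^ m) * (ennreal (2 powi (- (0 + int m))) * indicator (cball 0 (2 powi (0 + int m))) t)" "{m}"]
    by (intro mult_left_mono) auto
  finally show ?thesis .
qed

lemma bump_scale: "ennreal (2 powi (-k)) * bump 0 (2 powi (-k) * t) = bump k t"
proof -
  have "(2 powi (-k) * t \<in> cball 0 (2 powi (int m))) \<longleftrightarrow> (t \<in> cball 0 (2 powi (k + int m)))" for m
    by (simp add: abs_mult power_int_minus power_int_add divide_simps mult.commute)
  then have i: "(indicator (cball 0 (2 powi (int m))) (2 powi (-k) * t) :: ennreal) = indicator (cball 0 (2 powi (k + int m))) t" for m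
    by (auto simp: indicator_def)
  have e: "ennreal (2 powi (-(k + int m))) = ennreal (2 powi (-k)) * ennreal (2 powi (- int m))" for m
    by (simp flip: ennreal_mult power_int_add)
  show ?thesis
    unfolding bump_def
    by (subst ennreal_suminf_cmult[symmetric], intro suminf_cong) (simp only: add_0 i e mult.assoc mult.left_commute)
qed

subsection \<open>Bilinear forms with annular kernels\<close>

definition form ::
  "(real \<times> real \<Rightarrow> ennreal) \<Rightarrow> (real \<Rightarrow> ennreal) \<Rightarrow> (real \<Rightarrow> ennreal) \<Rightarrow> real \<Rightarrow> ennreal" where
  "form K g1 g2 x = (\<integral>\<^sup>+ z. K z * (g1 (x - fst z) * g2 (x - snd z)) \<partial>lborel)"

lemma fst_borel [measurable (raw)]:
  fixes f :: "'a \<Rightarrow> real \<times> real"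
  assumes "f \<in> borel_measurable M"
  shows "(\<lambda>x. fst (f x)) \<in> borel_measurable M"
  using assms unfolding borel_prod[symmetric] by measurable

lemma snd_borel [measurable (raw)]:
  fixes f :: "'a \<Rightarrow> real \<times> real"
  assumes "f \<in> borel_measurable M"
  shows "(\<lambda>x. snd (f x)) \<in> borel_measurable M"
  using assms unfolding borel_prod[symmetric] by measurable

lemma form_measurable [measurable]:
  assumes [measurable]: "K \<in> borel_measurable borel" "g1 \<in> borel_measurable borel" "g2 \<in> borel_measurable borel"
  shows "form K g1 g2 \<in> borel_measurable borel"
proof -
  have "(\<lambda>(x, z). K z * (g1 (x - fst z) * g2 (x - snd z))) \<in> borel_measurable (borel \<Otimes>\<^sub>M lborel)"
    unfolding case_prod_unfold by measurable
  then show ?thesis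
    unfolding form_def[abs_def] by (rule lborel.borel_measurable_nn_integral)
qed

section \<open>Changes of variables on the line and in the plane\<close>

lemma nn_integral_reflect:
  assumes [measurable]: "f \<in> borel_measurable borel"
  shows "(\<integral>\<^sup>+ x. f (c - x) \<partial>lborel) = (\<integral>\<^sup>+ x. f x \<partial>(lborel :: real measure))"
  using nn_integral_real_affine[of f "-1" c] by simp

lemma nn_integral_translate:
  assumes [measurable]: "f \<in> borel_measurable borel"
  shows "(\<integral>\<^sup>+ x. f (c + x) \<partial>lborel) = (\<integral>\<^sup>+ x. f x \<partial>(lborel :: real measure))"
  using nn_integral_real_affine[of f 1 c] by simp

lemma nn_integral_plane:
  fixes G :: "real \<times> real \<Rightarrow> ennreal"
  assumes [measurable]: "G \<in> borel_measurable borel"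
  shows "(\<integral>\<^sup>+ z. G z \<partial>lborel) = (\<integral>\<^sup>+ s. \<integral>\<^sup>+ t. G (s, t) \<partial>lborel \<partial>lborel)"
proof -
  have [measurable]: "G \<in> borel_measurable (borel \<Otimes>\<^sub>M borel)" unfolding borel_prod by measurable
  show ?thesis
    unfolding lborel_prod[symmetric] by (rule lborel.nn_integral_fst[symmetric]) measurable
qed

text \<open>The shear \<open>(s, d) \<mapsto> (s, s + d)\<close> preserves area and foliates the
  plane by lines parallel to the diagonal, the lines on which the kernel is controlled.\<close>

lemma nn_integral_plane_shear:
  fixes G :: "real \<times> real \<Rightarrow> ennreal"
  assumes [measurable]: "G \<in> borel_measurable borel"
  shows "(\<integral>\<^sup>+ z. G z \<partial>lborel) = (\<integral>\<^sup>+ d. \<integral>\<^sup>+ s. G (s, s + d) \<partial>lborel \<partial>lborel)"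
proof -
  have [measurable]: "G \<in> borel_measurable (borel \<Otimes>\<^sub>M borel)" unfolding borel_prod by measurable
  have "(\<integral>\<^sup>+ z. G z \<partial>lborel) = (\<integral>\<^sup>+ s. \<integral>\<^sup>+ t. G (s, t) \<partial>lborel \<partial>lborel)"
    by (rule nn_integral_plane) measurable
  also have "\<dots> = (\<integral>\<^sup>+ s. \<integral>\<^sup>+ d. G (s, s + d) \<partial>lborel \<partial>lborel)"
    by (intro nn_integral_cong nn_integral_translate[symmetric]) measurable
  also have "\<dots> = (\<integral>\<^sup>+ d. \<integral>\<^sup>+ s. G (s, s + d) \<partial>lborel \<partial>lborel)"
    by (rule lborel_pair.Fubini') measurable
  finally show ?thesis .
qed

text \<open>The line \<open>d = 0\<close> is left out: a finite weighted norm gives no pointwise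
  control in the two directions where \<open>u1\<close> is infinite, and one value of
  \<open>d\<close> is negligible when integrating over \<open>d\<close>. The weighted norm of
  \<open>\<Omega>\<close> is normalised to one here.\<close>

locale annular_kernel =
  fixes K :: "real \<times> real \<Rightarrow> ennreal" and \<gamma> :: int
  assumes kernel_measurable [measurable]: "K \<in> borel_measurable borel"
    and support: "K z \<noteq> 0 \<Longrightarrow> \<bar>fst z\<bar> \<le> 2 powi (\<gamma> + 1) \<and> \<bar>snd z\<bar> \<le> 2 powi (\<gamma> + 1)"
    and diagonal: "d \<noteq> 0 \<Longrightarrow> (\<integral>\<^sup>+ s. K (s, s + d) \<partial>lborel) \<le> ennreal (2 powi (- \<gamma>))"
begin

lemma support_diagonal: "K (s, s + d) \<noteq> 0 \<Longrightarrow> \<bar>d\<bar> \<le> 2 powi (\<gamma> + 2)"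
proof -
  have "(2::real) powi (\<gamma> + 2) = 2 * 2 powi (\<gamma> + 1)" by (simp add: power_int_add)
  moreover assume "K (s, s + d) \<noteq> 0"
  then have "\<bar>s\<bar> \<le> 2 powi (\<gamma> + 1)" "\<bar>s + d\<bar> \<le> 2 powi (\<gamma> + 1)"
    using support[of "(s, s + d)"] by simp_all
  ultimately show "\<bar>d\<bar> \<le> 2 powi (\<gamma> + 2)" by linarith
qed

text \<open>Exchanging the coordinates replaces \<open>d\<close> by \<open>- d\<close> and leaves
  all three conditions intact, so estimates for one argument of the form transfer to the
  other.\<close>

lemma kernel_swap: "annular_kernel (\<lambda>z. K (snd z, fst z)) \<gamma>"
proof
  show "(\<lambda>z. K (snd z, fst z)) \<in> borel_measurable borel"
    by (rule measurable_compose[OF _ kernel_measurable]) (simp add: borel_prod[symmetric])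
next
  fix d :: real assume d: "d \<noteq> 0"
  have [measurable]: "(\<lambda>s. K (s + d, s)) \<in> borel_measurable borel"
    by (rule measurable_compose[OF _ kernel_measurable]) (simp add: borel_prod[symmetric])
  have "(\<integral>\<^sup>+ s. K (s + d, s) \<partial>lborel) = (\<integral>\<^sup>+ s. K (s, s + - d) \<partial>lborel)"
    using nn_integral_translate[of "\<lambda>s. K (s + d, s)" "- d"] by (simp add: algebra_simps)
  also have "\<dots> \<le> ennreal (2 powi (- \<gamma>))" using d by (intro diagonal) simp
  finally show "(\<integral>\<^sup>+ s. K (snd (s, s + d), fst (s, s + d)) \<partial>lborel) \<le> ennreal (2 powi - \<gamma>)" by simp
qed (use support in auto)

lemma diagonal_indicator:
  assumes "d \<noteq> 0"
  shows "(\<integral>\<^sup>+ s. K (s, s + d) \<partial>lborel) \<le> ennreal (2 powi (- \<gamma>)) * indicator (cball 0 (2 powi (\<gamma> + 2))) d"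
proof (cases "\<bar>d\<bar> \<le> 2 powi (\<gamma> + 2)")
  case True
  then show ?thesis using diagonal[OF assms] by simp
next
  case False
  then have "K (s, s + d) = 0" for s using support_diagonal by blast
  then show ?thesis by simp
qed

text \<open>The support confines \<open>d\<close> to an interval of length
  \<open>2 * 2 powi (\<gamma> + 2)\<close>, which the line bound \<open>2 powi (- \<gamma>)\<close>
  turns into 8, independently of the scale.\<close>

lemma mass: "(\<integral>\<^sup>+ z. K z \<partial>lborel) \<le> 8"
proof -
  have "(\<integral>\<^sup>+ z. K z \<partial>lborel) = (\<integral>\<^sup>+ d. \<integral>\<^sup>+ s. K (s, s + d) \<partial>lborel \<partial>lborel)"
    by (rule nn_integral_plane_shear) measurable
  also have "\<dots> \<le> (\<integral>\<^sup>+ d. ennreal (2 powi (- \<gamma>)) * indicator (cball 0 (2 powi (\<gamma> + 2))) (d::real) \<partial>lborel)"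
    by (rule nn_integral_mono_AE, rule eventually_mono[OF AE_lborel_singleton[of 0]]) (auto intro: diagonal_indicator)
  also have "\<dots> = ennreal (2 powi (- \<gamma>)) * ennreal (2 * 2 powi (\<gamma> + 2))"
    by (simp add: nn_integral_cmult emeasure_lborel_cball_real)
  also have "\<dots> = ennreal (2 powi (- \<gamma>) * (2 * 2 powi (\<gamma> + 2)))"
    by (rule ennreal_mult[symmetric]) auto
  also have "2 powi (- \<gamma>) * (2 * 2 powi (\<gamma> + 2)) = (8::real)"
    by (simp add: power_int_add power_int_minus)
  finally show ?thesis by simp
qed

lemma nn_integral_form_left:
  assumes [measurable]: "g \<in> borel_measurable borel"
  shows "(\<integral>\<^sup>+ x. form K g (\<lambda>_. 1) x \<partial>lborel) \<le> 8 * (\<integral>\<^sup>+ t. g t \<partial>lborel)"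
proof -
  have "(\<integral>\<^sup>+ x. form K g (\<lambda>_. 1) x \<partial>lborel) = (\<integral>\<^sup>+ z. \<integral>\<^sup>+ x. K z * g (x - fst z) \<partial>lborel \<partial>lborel)"
    unfolding form_def mult_1_right by (rule lborel_pair.Fubini') measurable
  also have "\<dots> = (\<integral>\<^sup>+ z. K z * (\<integral>\<^sup>+ t. g t \<partial>lborel) \<partial>lborel)"
  proof (rule nn_integral_cong)
    fix z :: "real \<times> real"
    show "(\<integral>\<^sup>+ x. K z * g (x - fst z) \<partial>lborel) = K z * (\<integral>\<^sup>+ t. g t \<partial>lborel)"
      using nn_integral_translate[of g "- fst z"] by (simp add: nn_integral_cmult)
  qed
  also have "\<dots> = (\<integral>\<^sup>+ z. K z \<partial>lborel) * (\<integral>\<^sup>+ t. g t \<partial>lborel)"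
    by (rule nn_integral_multc) measurable
  also have "\<dots> \<le> 8 * (\<integral>\<^sup>+ t. g t \<partial>lborel)"
    by (intro mult_right_mono mass) auto
  finally show ?thesis .
qed

lemma form_swap:
  assumes [measurable]: "g1 \<in> borel_measurable borel" "g2 \<in> borel_measurable borel"
  shows "form (\<lambda>z. K (snd z, fst z)) g2 g1 x = form K g1 g2 x"
proof -
  interpret swap: annular_kernel "\<lambda>z. K (snd z, fst z)" \<gamma> by (rule kernel_swap)
  have [measurable]: "K \<in> borel_measurable (borel \<Otimes>\<^sub>M borel)" unfolding borel_prod by measurable
  have 1: "(\<lambda>z. K (snd z, fst z) * (g2 (x - fst z) * g1 (x - snd z))) \<in> borel_measurable borel"
    by measurable
  have 2: "(\<lambda>z. K z * (g1 (x - fst z) * g2 (x - snd z))) \<in> borel_measurable borel" by measurable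
  have "(\<integral>\<^sup>+ s. \<integral>\<^sup>+ t. K (t, s) * (g2 (x - s) * g1 (x - t)) \<partial>lborel \<partial>lborel)
      = (\<integral>\<^sup>+ t. \<integral>\<^sup>+ s. K (t, s) * (g2 (x - s) * g1 (x - t)) \<partial>lborel \<partial>lborel)"
    by (rule lborel_pair.Fubini') measurable
  then show ?thesis
    unfolding form_def nn_integral_plane[OF 1] nn_integral_plane[OF 2] by (simp add: mult.commute)
qed

lemma nn_integral_form_right:
  assumes [measurable]: "g \<in> borel_measurable borel"
  shows "(\<integral>\<^sup>+ x. form K (\<lambda>_. 1) g x \<partial>lborel) \<le> 8 * (\<integral>\<^sup>+ t. g t \<partial>lborel)"
proof -
  interpret swap: annular_kernel "\<lambda>z. K (snd z, fst z)" \<gamma> by (rule kernel_swap)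
  have "(\<integral>\<^sup>+ x. form K (\<lambda>_. 1) g x \<partial>lborel) = (\<integral>\<^sup>+ x. form (\<lambda>z. K (snd z, fst z)) g (\<lambda>_. 1) x \<partial>lborel)"
    by (intro nn_integral_cong form_swap[symmetric]) measurable
  then show ?thesis using swap.nn_integral_form_left[OF assms] by simp
qed

text \<open>For fixed \<open>s\<close> and \<open>d\<close> the integral over \<open>x\<close> is
  translation invariant and leaves the correlation of \<open>g1\<close> and \<open>g2\<close> at lag
  \<open>d\<close>. The remaining integral over \<open>s\<close> is the line bound, and the support
  restricts the lag to \<open>\<bar>d\<bar> \<le> 2 powi (\<gamma> + 2)\<close>, so only the mass of
  \<open>g2\<close> near \<open>u\<close> survives.\<close>

lemma nn_integral_form_le:
  assumes [measurable]: "g1 \<in> borel_measurable borel" "g2 \<in> borel_measurable borel"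
  shows "(\<integral>\<^sup>+ x. form K g1 g2 x \<partial>lborel) \<le>
    ennreal (2 powi (- \<gamma>)) * (\<integral>\<^sup>+ u. g1 u * (\<integral>\<^sup>+ t. g2 t * indicator (cball u (2 powi (\<gamma> + 2))) t \<partial>lborel) \<partial>lborel)"
proof -
  have [measurable]: "K \<in> borel_measurable (borel \<Otimes>\<^sub>M borel)" unfolding borel_prod by measurable
  have "(\<integral>\<^sup>+ x. form K g1 g2 x \<partial>lborel) =
      (\<integral>\<^sup>+ x. \<integral>\<^sup>+ d. \<integral>\<^sup>+ s. K (s, s + d) * (g1 (x - s) * g2 (x - (s + d))) \<partial>lborel \<partial>lborel \<partial>lborel)"
  proof (rule nn_integral_cong)
    fix x
    have "(\<lambda>z. K z * (g1 (x - fst z) * g2 (x - snd z))) \<in> borel_measurable borel" by measurable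
    from nn_integral_plane_shear[OF this]
    show "form K g1 g2 x = (\<integral>\<^sup>+ d. \<integral>\<^sup>+ s. K (s, s + d) * (g1 (x - s) * g2 (x - (s + d))) \<partial>lborel \<partial>lborel)"
      by (simp add: form_def)
  qed
  also have "\<dots> = (\<integral>\<^sup>+ d. \<integral>\<^sup>+ x. \<integral>\<^sup>+ s. K (s, s + d) * (g1 (x - s) * g2 (x - (s + d))) \<partial>lborel \<partial>lborel \<partial>lborel)"
    by (rule lborel_pair.Fubini') measurable
  also have "\<dots> = (\<integral>\<^sup>+ d. \<integral>\<^sup>+ s. \<integral>\<^sup>+ x. K (s, s + d) * (g1 (x - s) * g2 (x - (s + d))) \<partial>lborel \<partial>lborel \<partial>lborel)"
    by (intro nn_integral_cong lborel_pair.Fubini') measurable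
  also have "\<dots> = (\<integral>\<^sup>+ d. \<integral>\<^sup>+ s. K (s, s + d) * (\<integral>\<^sup>+ u. g1 u * g2 (u - d) \<partial>lborel) \<partial>lborel \<partial>lborel)"
  proof (intro nn_integral_cong)
    fix d s :: real
    show "(\<integral>\<^sup>+ x. K (s, s + d) * (g1 (x - s) * g2 (x - (s + d))) \<partial>lborel) = K (s, s + d) * (\<integral>\<^sup>+ u. g1 u * g2 (u - d) \<partial>lborel)"
      using nn_integral_translate[of "\<lambda>u. g1 u * g2 (u - d)" "- s"]
      by (subst nn_integral_cmult) (simp_all add: diff_diff_eq)
  qed
  also have "\<dots> = (\<integral>\<^sup>+ d. (\<integral>\<^sup>+ s. K (s, s + d) \<partial>lborel) * (\<integral>\<^sup>+ u. g1 u * g2 (u - d) \<partial>lborel) \<partial>lborel)"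
    by (intro nn_integral_cong nn_integral_multc) measurable
  also have "\<dots> \<le> (\<integral>\<^sup>+ d. (ennreal (2 powi (- \<gamma>)) * indicator (cball 0 (2 powi (\<gamma> + 2))) d) * (\<integral>\<^sup>+ u. g1 u * g2 (u - d) \<partial>lborel) \<partial>lborel)"
    by (rule nn_integral_mono_AE, rule eventually_mono[OF AE_lborel_singleton[of 0]]) (auto intro!: mult_right_mono diagonal_indicator)
  also have "\<dots> = (\<integral>\<^sup>+ d. \<integral>\<^sup>+ u. ennreal (2 powi (- \<gamma>)) * (g1 u * (g2 (u - d) * indicator (cball 0 (2 powi (\<gamma> + 2))) d)) \<partial>lborel \<partial>lborel)"
    by (intro nn_integral_cong, subst nn_integral_cmult[symmetric]) (measurable, simp add: mult_ac)
  also have "\<dots> = (\<integral>\<^sup>+ u. \<integral>\<^sup>+ d. ennreal (2 powi (- \<gamma>)) * (g1 u * (g2 (u - d) * indicator (cball 0 (2 powi (\<gamma> + 2))) d)) \<partial>lborel \<partial>lborel)"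
    by (rule lborel_pair.Fubini') measurable
  also have "\<dots> = (\<integral>\<^sup>+ u. ennreal (2 powi (- \<gamma>)) * (g1 u * (\<integral>\<^sup>+ t. g2 t * indicator (cball u (2 powi (\<gamma> + 2))) t \<partial>lborel)) \<partial>lborel)"
  proof (intro nn_integral_cong)
    fix u :: real
    have "(\<integral>\<^sup>+ d. g2 (u - d) * indicator (cball 0 (2 powi (\<gamma> + 2))) d \<partial>lborel)
        = (\<integral>\<^sup>+ t. g2 t * indicator (cball u (2 powi (\<gamma> + 2))) t \<partial>lborel)"
      using nn_integral_reflect[of "\<lambda>t. g2 t * indicator (cball u (2 powi (\<gamma> + 2))) t" u]
      by (simp add: dist_real_def indicator_def)
    then show "(\<integral>\<^sup>+ d. ennreal (2 powi (- \<gamma>)) * (g1 u * (g2 (u - d) * indicator (cball 0 (2 powi (\<gamma> + 2))) d)) \<partial>lborel)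
      = ennreal (2 powi (- \<gamma>)) * (g1 u * (\<integral>\<^sup>+ t. g2 t * indicator (cball u (2 powi (\<gamma> + 2))) t \<partial>lborel))"
      by (simp add: nn_integral_cmult)
  qed
  also have "\<dots> = ennreal (2 powi (- \<gamma>)) * (\<integral>\<^sup>+ u. g1 u * (\<integral>\<^sup>+ t. g2 t * indicator (cball u (2 powi (\<gamma> + 2))) t \<partial>lborel) \<partial>lborel)"
    by (rule nn_integral_cmult) measurable
  finally show ?thesis .
qed

end

lemma powi_Suc: "(2::real) powi (j + 1) = 2 * 2 powi j"
  by (simp add: power_int_add)

context annular_kernel
begin

text \<open>Locality: the value at \<open>x\<close> involves the functions only within distance
  \<open>2 powi (\<gamma> + 1)\<close>, so information about maximal averages at the single point
  \<open>x\<close> can be used.\<close>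

lemma form_mono:
  assumes "\<And>u. \<bar>x - u\<bar> \<le> 2 powi (\<gamma> + 1) \<Longrightarrow> g1 u \<le> h1 u"
    and "\<And>u. \<bar>x - u\<bar> \<le> 2 powi (\<gamma> + 1) \<Longrightarrow> g2 u \<le> h2 u"
  shows "form K g1 g2 x \<le> form K h1 h2 x"
  unfolding form_def
proof (rule nn_integral_mono)
  fix z
  show "K z * (g1 (x - fst z) * g2 (x - snd z)) \<le> K z * (h1 (x - fst z) * h2 (x - snd z))"
  proof (cases "K z = 0")
    case False
    then show ?thesis
      using support[OF False] by (intro mult_left_mono mult_mono assms) auto
  qed simp
qed

text \<open>Multiplying out separates the bounded part: the constant term is paid by the mass of the
  kernel, and each mixed term is linear in one function and open to a plain Markov bound.\<close>

lemma form_shift: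
  assumes [measurable]: "g1 \<in> borel_measurable borel" "g2 \<in> borel_measurable borel"
  shows "form K (\<lambda>t. a + g1 t) (\<lambda>t. a + g2 t) x
    \<le> 8 * (a * a) + a * form K g1 (\<lambda>_. 1) x + a * form K (\<lambda>_. 1) g2 x + form K g1 g2 x"
proof -
  have "form K (\<lambda>t. a + g1 t) (\<lambda>t. a + g2 t) x
    = (\<integral>\<^sup>+ z. a * a * K z + a * (K z * g1 (x - fst z)) + a * (K z * g2 (x - snd z))
        + K z * (g1 (x - fst z) * g2 (x - snd z)) \<partial>lborel)"
    unfolding form_def by (intro nn_integral_cong) (simp add: distrib_left distrib_right mult_ac add_ac)
  also have "\<dots> = a * a * (\<integral>\<^sup>+ z. K z \<partial>lborel) + a * form K g1 (\<lambda>_. 1) x + a * form K (\<lambda>_. 1) g2 x + form K g1 g2 x"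
    unfolding form_def by (simp add: nn_integral_add nn_integral_cmult)
  also have "\<dots> \<le> a * a * 8 + a * form K g1 (\<lambda>_. 1) x + a * form K (\<lambda>_. 1) g2 x + form K g1 g2 x"
    by (intro add_right_mono mult_left_mono mass) auto
  finally show ?thesis by (simp add: mult.commute)
qed

text \<open>At a single scale the form behaves like a map into \<open>L\<^sup>1\<close> with norm \<open>2\<^sup>-\<^sup>\<gamma>\<close>, localised to
  intervals of length \<open>2\<^sup>\<gamma>\<close>. Cutting off where \<open>g2\<close> has mass more than \<open>2\<^sup>\<gamma> sqrt l\<close> nearby
  replaces the use of the quasi-norm of \<open>L\<^sup>1\<^sup>/\<^sup>2\<close>.\<close>

lemma emeasure_form_gt:
  assumes [measurable]: "g1 \<in> borel_measurable borel" "g2 \<in> borel_measurable borel" and l: "l > 0"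
  shows "emeasure lborel {x. form K g1 g2 x > ennreal l}
    \<le> ennreal (16 / sqrt l) * ((\<integral>\<^sup>+ t. g1 t \<partial>lborel) + (\<integral>\<^sup>+ t. g2 t \<partial>lborel))"
proof -
  \<comment> \<open>The threshold balances two Markov inequalities: removing the points with large
    nearby mass costs a multiple of \<open>2 powi \<gamma> / T\<close>, the remaining form costs
    \<open>2 powi (- \<gamma>) * T / l\<close>, and both become a multiple of
    \<open>1 / sqrt l\<close>.\<close>
  define T where "T = 2 powi \<gamma> * sqrt l"
  have T: "T > 0" using l by (simp add: T_def)
  define b where "b r u = (\<integral>\<^sup>+ t. g2 t * indicator (cball u r) t \<partial>lborel)" for r u
  have [measurable]: "b r \<in> borel_measurable borel" for r unfolding b_def[abs_def] by measurable
  define h where "h u = g1 u * indicator {u. b (2 powi (\<gamma> + 2)) u \<le> ennreal T} u" for u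
  have [measurable]: "h \<in> borel_measurable borel" unfolding h_def[abs_def] by measurable
  let ?V = "{x. b (2 powi (\<gamma> + 3)) x > ennreal T}"
  \<comment> \<open>Outside \<open>?V\<close> the cut-off is invisible at \<open>x\<close>: the
    interval of radius \<open>2 powi (\<gamma> + 2)\<close> around any relevant \<open>u\<close>
    lies in the one of radius \<open>2 powi (\<gamma> + 3)\<close> around \<open>x\<close>.\<close>
  have sub: "{x. form K g1 g2 x > ennreal l} \<subseteq> ?V \<union> {x. form K h g2 x > ennreal l}"
  proof
    fix x assume "x \<in> {x. form K g1 g2 x > ennreal l}"
    then have x: "ennreal l < form K g1 g2 x" by simp
    show "x \<in> ?V \<union> {x. form K h g2 x > ennreal l}"
    proof (cases "x \<in> ?V")
      case False
      then have nV: "\<not> ennreal T < b (2 powi (\<gamma> + 3)) x" by simp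
    have "form K g1 g2 x \<le> form K h g2 x"
    proof (rule form_mono)
      fix u assume u: "\<bar>x - u\<bar> \<le> 2 powi (\<gamma> + 1)"
      have "cball u (2 powi (\<gamma> + 2)) \<subseteq> cball x (2 powi (\<gamma> + 3))"
        using u powi_Suc[of "\<gamma> + 1"] powi_Suc[of "\<gamma> + 2"]
        by (auto simp: dist_real_def add.assoc)
      then have "b (2 powi (\<gamma> + 2)) u \<le> b (2 powi (\<gamma> + 3)) x"
        unfolding b_def by (intro nn_integral_mono) (auto split: split_indicator)
      with nV show "g1 u \<le> h u" by (simp add: h_def)
    qed simp
    with x show ?thesis by (auto intro: less_le_trans)
    qed simp
  qed
  have "emeasure lborel ?V \<le> ennreal (1 / T) * (\<integral>\<^sup>+ x. b (2 powi (\<gamma> + 3)) x \<partial>lborel)"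
    using markov_ennreal[of "b (2 powi (\<gamma> + 3))" lborel T] T by simp
  also have "(\<integral>\<^sup>+ x. b (2 powi (\<gamma> + 3)) x \<partial>lborel) = ennreal (16 * 2 powi \<gamma>) * (\<integral>\<^sup>+ t. g2 t \<partial>lborel)"
  proof -
    have e: "(16::real) * 2 powi \<gamma> = 2 powi (\<gamma> + 3) * 2" by (simp add: power_int_add)
    show ?thesis
      unfolding b_def cball_integral_eq_avg e
      by (simp add: nn_integral_cmult nn_integral_avg ennreal_mult mult.assoc)
  qed
  also have "ennreal (1 / T) * (ennreal (16 * 2 powi \<gamma>) * (\<integral>\<^sup>+ t. g2 t \<partial>lborel)) = ennreal (16 / sqrt l) * (\<integral>\<^sup>+ t. g2 t \<partial>lborel)"
    using T l by (simp add: mult.assoc[symmetric] T_def flip: ennreal_mult)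
  finally have V: "emeasure lborel ?V \<le> ennreal (16 / sqrt l) * (\<integral>\<^sup>+ t. g2 t \<partial>lborel)" .
  have "(\<integral>\<^sup>+ x. form K h g2 x \<partial>lborel) \<le> ennreal (2 powi (- \<gamma>)) * (\<integral>\<^sup>+ u. h u * b (2 powi (\<gamma> + 2)) u \<partial>lborel)"
    unfolding b_def by (rule nn_integral_form_le) measurable
  also have "\<dots> \<le> ennreal (2 powi (- \<gamma>)) * (\<integral>\<^sup>+ u. g1 u * ennreal T \<partial>lborel)"
    unfolding h_def by (intro mult_left_mono nn_integral_mono) (auto split: split_indicator intro: mult_left_mono)
  also have "\<dots> = ennreal (2 powi (- \<gamma>)) * ((\<integral>\<^sup>+ t. g1 t \<partial>lborel) * ennreal T)"
    by (subst nn_integral_multc) auto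
  also have "\<dots> = ennreal (2 powi (- \<gamma>) * T) * (\<integral>\<^sup>+ t. g1 t \<partial>lborel)"
    using T by (subst ennreal_mult) (auto simp: mult_ac)
  also have "2 powi (- \<gamma>) * T = sqrt l"
    by (simp add: T_def power_int_minus)
  finally have "(\<integral>\<^sup>+ x. form K h g2 x \<partial>lborel) \<le> ennreal (sqrt l) * (\<integral>\<^sup>+ t. g1 t \<partial>lborel)" .
  then have "emeasure lborel {x. form K h g2 x > ennreal l} \<le> ennreal (1 / l) * (ennreal (sqrt l) * (\<integral>\<^sup>+ t. g1 t \<partial>lborel))"
    using markov_ennreal[of "form K h g2" lborel l] l by (auto elim!: order_trans intro: mult_left_mono)
  also have "\<dots> = ennreal (1 / sqrt l) * (\<integral>\<^sup>+ t. g1 t \<partial>lborel)"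
  proof -
    have "1 / l * sqrt l = 1 / sqrt l" using l by (simp add: field_simps)
    then show ?thesis using l by (simp add: mult.assoc[symmetric] flip: ennreal_mult)
  qed
  also have "\<dots> \<le> ennreal (16 / sqrt l) * (\<integral>\<^sup>+ t. g1 t \<partial>lborel)"
    using l by (intro mult_right_mono ennreal_leI divide_right_mono) auto
  finally have H: "emeasure lborel {x. form K h g2 x > ennreal l} \<le> ennreal (16 / sqrt l) * (\<integral>\<^sup>+ t. g1 t \<partial>lborel)" .
  have "emeasure lborel {x. form K g1 g2 x > ennreal l} \<le> emeasure lborel (?V \<union> {x. form K h g2 x > ennreal l})"
    by (rule emeasure_mono[OF sub]) measurable
  also have "\<dots> \<le> emeasure lborel ?V + emeasure lborel {x. form K h g2 x > ennreal l}"
    by (rule emeasure_subadditive) measurable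
  also have "\<dots> \<le> ennreal (16 / sqrt l) * (\<integral>\<^sup>+ t. g2 t \<partial>lborel) + ennreal (16 / sqrt l) * (\<integral>\<^sup>+ t. g1 t \<partial>lborel)"
    by (rule add_mono[OF V H])
  finally show ?thesis by (simp add: distrib_left add.commute)
qed

end

subsection \<open>Stopping scales and the weak-type estimate\<close>

text \<open>The last scale with average above \<open>\<alpha>\<close> lies in
  \<open>{k..n - 1}\<close>. Phrased with one existential and one universal condition over countably
  many scales, the set is Borel without that last scale being chosen.\<close>

definition heavy :: "real \<Rightarrow> (real \<Rightarrow> ennreal) \<Rightarrow> int \<Rightarrow> int \<Rightarrow> real set" where
  "heavy \<alpha> f k n = {t. (\<exists>j\<ge>k. avg j f t > ennreal \<alpha>) \<and> (\<forall>j\<ge>n. avg j f t \<le> ennreal \<alpha>)}"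

lemma heavy_measurable [measurable]:
  assumes [measurable]: "f \<in> borel_measurable borel"
  shows "heavy \<alpha> f k n \<in> sets borel"
proof -
  have "{t \<in> space borel. (\<exists>j\<in>{k..}. avg j f t > ennreal \<alpha>) \<and> (\<forall>j\<in>{n..}. avg j f t \<le> ennreal \<alpha>)} \<in> sets borel"
    by measurable
  then show ?thesis by (simp add: heavy_def)
qed

lemma avg_eq_0:
  assumes "\<And>t. t \<in> cball u (2 powi j) \<Longrightarrow> f t = 0"
  shows "avg j f u = 0"
proof -
  have "(\<integral>\<^sup>+ t. f t * indicator (cball u (2 powi j)) t \<partial>lborel) = (\<integral>\<^sup>+ t. 0 \<partial>(lborel :: real measure))"
    using assms by (intro nn_integral_cong) (auto split: split_indicator)
  then show ?thesis by (simp add: avg_def)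
qed

lemma avg_mono: "(\<And>t. f t \<le> g t) \<Longrightarrow> avg j f u \<le> avg j g u"
  unfolding avg_def by (intro mult_left_mono nn_integral_mono mult_right_mono) auto

lemma avg_add:
  assumes [measurable]: "f \<in> borel_measurable borel" "g \<in> borel_measurable borel"
  shows "avg j (\<lambda>t. f t + g t) u = avg j f u + avg j g u"
  unfolding avg_def by (simp add: distrib_right nn_integral_add distrib_left)

lemma avg_le_twice:
  assumes "dist u t \<le> 2 powi j"
  shows "avg j f u \<le> 2 * avg (j + 1) f t"
proof -
  have "cball u (2 powi j) \<subseteq> cball t (2 powi (j + 1))"
    using assms by (auto simp: powi_Suc dist_real_def)
  from avg_le_avg[OF this] show ?thesis by simp
qed

lemma avg_le_four:
  assumes "dist u t \<le> 3 * 2 powi j"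
  shows "avg j f u \<le> 4 * avg (j + 2) f t"
proof -
  have "cball u (2 powi j) \<subseteq> cball t (2 powi (j + 2))"
    using assms by (auto simp: power_int_add dist_real_def)
  from avg_le_avg[OF this] show ?thesis by simp
qed

text \<open>The points are split into \<open>A\<close>, light at all scales from \<open>k\<close>
  on, \<open>B\<close>, still heavy at some scale from \<open>\<gamma> + 2\<close> on, and the heavy
  set in between. An average that meets \<open>A\<close> at \<open>t\<close> is compared with a
  doubled average at \<open>t\<close>. One that meets \<open>B\<close> is compared with an average
  at \<open>x\<close>, where every scale is below \<open>\<alpha> / 2\<close>.\<close>

lemma smooth_le_heavy:
  assumes [measurable]: "f \<in> borel_measurable borel" and \<alpha>: "\<alpha> > 0"
    and x: "\<And>j. avg j f x \<le> ennreal (\<alpha> / 2)" and u: "\<bar>x - u\<bar> \<le> 2 powi (\<gamma> + 1)"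
  shows "smooth k f u \<le> ennreal (8 * \<alpha>) + smooth k (\<lambda>t. f t * indicator (heavy \<alpha> f k (\<gamma> + 2)) t) u"
proof -
  define A where "A = {t. \<forall>j\<in>{k..}. avg j f t \<le> ennreal \<alpha>}"
  define B where "B = {t. \<exists>j\<in>{\<gamma> + 2..}. avg j f t > ennreal \<alpha>}"
  have [measurable]: "A \<in> sets borel"
  proof -
    have "{t \<in> space borel. \<forall>j\<in>{k..}. avg j f t \<le> ennreal \<alpha>} \<in> sets borel" by measurable
    then show ?thesis by (simp add: A_def)
  qed
  have [measurable]: "B \<in> sets borel"
  proof -
    have "{t \<in> space borel. \<exists>j\<in>{\<gamma> + 2..}. avg j f t > ennreal \<alpha>} \<in> sets borel" by measurable
    then show ?thesis by (simp add: B_def)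
  qed
  let ?h = "\<lambda>t. f t * indicator (heavy \<alpha> f k (\<gamma> + 2)) t"
  have avg_A: "avg j (\<lambda>t. f t * indicator A t) u \<le> ennreal (2 * \<alpha>)" if "j \<ge> k" for j
  proof (cases "\<exists>t\<in>A. dist u t \<le> 2 powi j")
    case True
    then obtain t where t: "t \<in> A" "dist u t \<le> 2 powi j" by auto
    have "avg j (\<lambda>t. f t * indicator A t) u \<le> avg j f u"
      by (rule avg_mono) (auto split: split_indicator)
    also have "\<dots> \<le> 2 * avg (j + 1) f t" using t(2) by (rule avg_le_twice)
    also have "\<dots> \<le> 2 * ennreal \<alpha>" using t(1) that by (intro mult_left_mono) (auto simp: A_def)
    finally show ?thesis using \<alpha> by (simp add: ennreal_mult)
  next
    case False
    then have "avg j (\<lambda>t. f t * indicator A t) u = 0"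
      by (intro avg_eq_0) (auto split: split_indicator)
    then show ?thesis by simp
  qed
  have avg_B: "avg j (\<lambda>t. f t * indicator B t) u \<le> ennreal (2 * \<alpha>)" for j
  proof (cases "\<exists>t\<in>B. dist u t \<le> 2 powi j")
    case True
    then obtain t i where t: "dist u t \<le> 2 powi j" and i: "i \<ge> \<gamma> + 2" "avg i f t > ennreal \<alpha>"
      by (auto simp: B_def)
    \<comment> \<open>A smaller interval would put \<open>t\<close> within
      \<open>2 powi (\<gamma> + 2)\<close> of \<open>x\<close>, and a heavy average at
      \<open>t\<close> on a scale at least that large would make an average at \<open>x\<close>
      exceed \<open>\<alpha> / 2\<close>.\<close>
    have "j \<ge> \<gamma>"
    proof (rule ccontr)
      assume "\<not> j \<ge> \<gamma>"
      then have "(2::real) powi j \<le> 2 powi \<gamma>" by (intro power_int_increasing) auto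
      moreover have "(2::real) powi (\<gamma> + 1) = 2 * 2 powi \<gamma>" "(2::real) powi (\<gamma> + 2) = 4 * 2 powi \<gamma>"
        by (simp_all add: power_int_add)
      moreover have "dist t x \<le> dist u t + \<bar>x - u\<bar>" by (simp add: dist_real_def)
      moreover have "(2::real) powi (\<gamma> + 2) \<le> 2 powi i" using i by (intro power_int_increasing) auto
      ultimately have "dist t x \<le> 2 powi i"
        using t u zero_less_power_int[of "2::real" \<gamma>] by linarith
      then have "avg i f t \<le> 2 * avg (i + 1) f x" by (rule avg_le_twice)
      also have "\<dots> \<le> 2 * ennreal (\<alpha> / 2)" by (intro mult_left_mono x) auto
      also have "\<dots> = ennreal (2 * (\<alpha> / 2))" using \<alpha> by (subst ennreal_mult) auto
      finally show False using i(2) by simp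
    qed
    then have "(2::real) powi \<gamma> \<le> 2 powi j" by (intro power_int_increasing) auto
    then have "dist u x \<le> 3 * 2 powi j"
      using u powi_Suc[of \<gamma>] zero_less_power_int[of "2::real" j] unfolding dist_real_def by linarith
    have "avg j (\<lambda>t. f t * indicator B t) u \<le> avg j f u"
      by (rule avg_mono) (auto split: split_indicator)
    also have "\<dots> \<le> 4 * avg (j + 2) f x" using \<open>dist u x \<le> 3 * 2 powi j\<close> by (rule avg_le_four)
    also have "\<dots> \<le> 4 * ennreal (\<alpha> / 2)" by (intro mult_left_mono x) auto
    also have "\<dots> = ennreal (4 * (\<alpha> / 2))" using \<alpha> by (subst ennreal_mult) auto
    finally show ?thesis by simp
  next
    case False
    then have "avg j (\<lambda>t. f t * indicator B t) u = 0"
      by (intro avg_eq_0) (auto split: split_indicator)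
    then show ?thesis by simp
  qed
  have avg_split: "avg j f u \<le> ennreal (4 * \<alpha>) + avg j ?h u" if "j \<ge> k" for j
  proof -
    have "avg j f u \<le> avg j (\<lambda>t. f t * indicator A t + (f t * indicator B t + ?h t)) u"
    proof (rule avg_mono)
      fix t
      have "t \<in> A \<or> t \<in> B \<or> t \<in> heavy \<alpha> f k (\<gamma> + 2)"
        unfolding A_def B_def heavy_def by (auto simp: not_less not_le)
      then show "f t \<le> f t * indicator A t + (f t * indicator B t + ?h t)"
        by (auto simp: add_increasing add_increasing2)
    qed
    also have "\<dots> = avg j (\<lambda>t. f t * indicator A t) u + (avg j (\<lambda>t. f t * indicator B t) u + avg j ?h u)"
      by (simp add: avg_add)
    also have "\<dots> \<le> ennreal (2 * \<alpha>) + (ennreal (2 * \<alpha>) + avg j ?h u)"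
      by (intro add_mono avg_A avg_B that order_refl)
    also have "\<dots> = ennreal (4 * \<alpha>) + avg j ?h u"
      using \<alpha> by (simp add: add.assoc[symmetric] flip: ennreal_plus)
    finally show ?thesis .
  qed
  have "smooth k f u = (\<Sum>m. ennreal ((1/2) ^ m) * avg (k + int m) f u)"
    by (rule smooth_eq_suminf) measurable
  also have "\<dots> \<le> (\<Sum>m. ennreal ((1/2) ^ m) * ennreal (4 * \<alpha>) + ennreal ((1/2) ^ m) * avg (k + int m) ?h u)"
    by (intro suminf_le summableI) (auto simp flip: distrib_left intro!: mult_left_mono avg_split)
  also have "\<dots> = (\<Sum>m. ennreal ((1/2) ^ m) * ennreal (4 * \<alpha>)) + (\<Sum>m. ennreal ((1/2) ^ m) * avg (k + int m) ?h u)"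
    by (rule suminf_add[symmetric]) (auto intro: summableI)
  \<comment> \<open>The weights \<open>(1/2) ^ m\<close> sum to 2, which doubles the bound
    \<open>4 * \<alpha>\<close> that \<open>A\<close> and \<open>B\<close> contribute to every
    average.\<close>
  also have "\<dots> = 2 * ennreal (4 * \<alpha>) + smooth k ?h u"
  proof -
    have "smooth k ?h u = (\<Sum>m. ennreal ((1/2) ^ m) * avg (k + int m) ?h u)"
      by (rule smooth_eq_suminf) measurable
    then show ?thesis by (simp only: ennreal_suminf_multc suminf_half_ennreal)
  qed
  also have "2 * ennreal (4 * \<alpha>) = ennreal (8 * \<alpha>)"
    using \<alpha> by (subst ennreal_numeral[symmetric], subst ennreal_mult[symmetric]) auto
  finally show ?thesis .
qed

text \<open>If \<open>J\<close> is the last scale with average above \<open>\<alpha>\<close> at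
  \<open>t\<close>, then membership forces \<open>J < \<gamma> + 2\<close> and
  \<open>\<gamma> - \<mu> \<le> J\<close>, which leaves the \<open>\<mu> + 2\<close> integers from
  \<open>J - 1\<close> to \<open>J + \<mu>\<close>.\<close>

lemma heavy_count:
  "(\<integral>\<^sup>+ \<gamma>. indicator (heavy \<alpha> f (\<gamma> - int \<mu>) (\<gamma> + 2)) t \<partial>count_space UNIV) \<le> ennreal (real \<mu> + 2)"
proof (cases "\<exists>\<gamma>. t \<in> heavy \<alpha> f (\<gamma> - int \<mu>) (\<gamma> + 2)")
  case False
  then show ?thesis by simp
next
  case True
  then obtain \<gamma>0 where g0: "t \<in> heavy \<alpha> f (\<gamma>0 - int \<mu>) (\<gamma>0 + 2)" ..
  define S where "S = {j. avg j f t > ennreal \<alpha>}"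
  have S_upper: "j < \<gamma> + 2" if "j \<in> S" "t \<in> heavy \<alpha> f (\<gamma> - int \<mu>) (\<gamma> + 2)" for j \<gamma>
  proof (rule ccontr)
    assume "\<not> j < \<gamma> + 2"
    then have "avg j f t \<le> ennreal \<alpha>" using that(2) unfolding heavy_def by auto
    then show False using that(1) unfolding S_def by (auto dest: leD)
  qed
  have S_lower: "\<exists>j\<ge>\<gamma> - int \<mu>. j \<in> S" if "t \<in> heavy \<alpha> f (\<gamma> - int \<mu>) (\<gamma> + 2)" for \<gamma>
    using that unfolding heavy_def S_def by blast
  \<comment> \<open>\<open>S\<close> may be unbounded below; cutting it at a scale below one of its
    members makes it finite and keeps its maximum.\<close>
  define R where "R = S \<inter> {\<gamma>0 - int \<mu>..}"
  have fin: "finite R"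
    by (rule finite_subset[of _ "{\<gamma>0 - int \<mu>..<\<gamma>0 + 2}"]) (auto simp: R_def S_upper[OF _ g0])
  have ne: "R \<noteq> {}" using S_lower[OF g0] by (auto simp: R_def)
  define J where "J = Max R"
  have J: "J \<in> S" "J \<ge> \<gamma>0 - int \<mu>" using Max_in[OF fin ne] by (auto simp: J_def R_def)
  have Jmax: "j \<le> J" if "j \<in> S" for j
  proof (cases "j \<ge> \<gamma>0 - int \<mu>")
    case True
    then show ?thesis using that fin unfolding J_def by (intro Max_ge) (auto simp: R_def)
  qed (use J in simp)
  have sub: "\<gamma> \<in> {J - 1..J + int \<mu>}" if h: "t \<in> heavy \<alpha> f (\<gamma> - int \<mu>) (\<gamma> + 2)" for \<gamma>
  proof -
    have "J < \<gamma> + 2" using J(1) h by (rule S_upper)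
    moreover obtain j where "j \<ge> \<gamma> - int \<mu>" "j \<in> S" using S_lower[OF h] by auto
    ultimately show ?thesis using Jmax[of j] by simp
  qed
  have "(\<integral>\<^sup>+ \<gamma>. indicator (heavy \<alpha> f (\<gamma> - int \<mu>) (\<gamma> + 2)) t \<partial>count_space UNIV)
      \<le> (\<integral>\<^sup>+ \<gamma>. indicator {J - 1..J + int \<mu>} \<gamma> \<partial>count_space UNIV)"
    using sub by (intro nn_integral_mono) (auto split: split_indicator)
  also have "\<dots> = of_nat (card {J - 1..J + int \<mu>})"
    by (simp only: nn_integral_indicator sets_count_space Pow_UNIV UNIV_I emeasure_count_space_finite subset_UNIV finite_atLeastAtMost_int)
  also have "card {J - 1..J + int \<mu>} = \<mu> + 2" by simp
  also have "of_nat (\<mu> + 2) = ennreal (real \<mu> + 2)"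
    unfolding ennreal_of_nat_eq_real_of_nat by simp
  finally show ?thesis .
qed

text \<open>Writing the sum over scales as an integral over counting measure lets it be exchanged
  with the integral over \<open>t\<close>, after which the count of scales applies
  pointwise.\<close>

lemma heavy_mass:
  assumes [measurable]: "f \<in> borel_measurable borel" and f1: "(\<integral>\<^sup>+ t. f t \<partial>lborel) \<le> 1"
  shows "(\<integral>\<^sup>+ \<gamma>. \<integral>\<^sup>+ t. f t * indicator (heavy \<alpha> f (\<gamma> - int \<mu>) (\<gamma> + 2)) t \<partial>lborel \<partial>count_space UNIV)
    \<le> ennreal (real \<mu> + 2)"
proof -
  have "(\<integral>\<^sup>+ \<gamma>. \<integral>\<^sup>+ t. f t * indicator (heavy \<alpha> f (\<gamma> - int \<mu>) (\<gamma> + 2)) t \<partial>lborel \<partial>count_space UNIV)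
      = (\<integral>\<^sup>+ t. \<integral>\<^sup>+ \<gamma>. f t * indicator (heavy \<alpha> f (\<gamma> - int \<mu>) (\<gamma> + 2)) t \<partial>count_space UNIV \<partial>lborel)"
    by (rule nn_integral_count_space_nn_integral[symmetric]) auto
  also have "\<dots> = (\<integral>\<^sup>+ t. f t * (\<integral>\<^sup>+ \<gamma>. indicator (heavy \<alpha> f (\<gamma> - int \<mu>) (\<gamma> + 2)) t \<partial>count_space UNIV) \<partial>lborel)"
    by (intro nn_integral_cong nn_integral_cmult) auto
  also have "\<dots> \<le> (\<integral>\<^sup>+ t. f t * ennreal (real \<mu> + 2) \<partial>lborel)"
    by (intro nn_integral_mono mult_left_mono heavy_count) auto
  also have "\<dots> = (\<integral>\<^sup>+ t. f t \<partial>lborel) * ennreal (real \<mu> + 2)"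
    by (rule nn_integral_multc) auto
  also have "\<dots> \<le> 1 * ennreal (real \<mu> + 2)"
    by (intro mult_right_mono f1) auto
  finally show ?thesis by simp
qed

text \<open>Each of the four terms of the expansion gets a quarter of the level. The constant one
  must fit deterministically: with \<open>a = 8 * sqrt l / 46\<close> it is
  \<open>512 / 2116 * l\<close>, just below \<open>l / 4\<close>, and 46 is the least integer for
  which this works.\<close>

lemma (in annular_kernel) emeasure_form_heavy:
  assumes [measurable]: "g1 \<in> borel_measurable borel" "g2 \<in> borel_measurable borel" and l: "l > 0"
  shows "emeasure lborel {x. form K (\<lambda>t. ennreal (8 * (sqrt l / 46)) + g1 t) (\<lambda>t. ennreal (8 * (sqrt l / 46)) + g2 t) x > ennreal l}
    \<le> ennreal (40 / sqrt l) * ((\<integral>\<^sup>+ t. g1 t \<partial>lborel) + (\<integral>\<^sup>+ t. g2 t \<partial>lborel))"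
proof -
  define a where "a = 8 * (sqrt l / 46)"
  have a: "a > 0" using l by (simp add: a_def)
  have a2: "8 * (a * a) \<le> l / 4" using l by (simp add: a_def)
  let ?G1 = "\<integral>\<^sup>+ t. g1 t \<partial>lborel" and ?G2 = "\<integral>\<^sup>+ t. g2 t \<partial>lborel"
  let ?S1 = "{x. form K g1 (\<lambda>_. 1) x > ennreal (l / (4 * a))}"
  let ?S2 = "{x. form K (\<lambda>_. 1) g2 x > ennreal (l / (4 * a))}"
  let ?S3 = "{x. form K g1 g2 x > ennreal (l / 4)}"
  have "{x. form K (\<lambda>t. ennreal a + g1 t) (\<lambda>t. ennreal a + g2 t) x > ennreal l} \<subseteq> ?S1 \<union> ?S2 \<union> ?S3"
  proof (rule ccontr)
    assume "\<not> ?thesis"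
    then obtain x where x: "form K (\<lambda>t. ennreal a + g1 t) (\<lambda>t. ennreal a + g2 t) x > ennreal l"
      and "x \<notin> ?S1" "x \<notin> ?S2" "x \<notin> ?S3" by blast
    then have n: "form K g1 (\<lambda>_. 1) x \<le> ennreal (l / (4 * a))" "form K (\<lambda>_. 1) g2 x \<le> ennreal (l / (4 * a))"
      "form K g1 g2 x \<le> ennreal (l / 4)" by (simp_all add: not_less)
    have "form K (\<lambda>t. ennreal a + g1 t) (\<lambda>t. ennreal a + g2 t) x
        \<le> 8 * (ennreal a * ennreal a) + ennreal a * form K g1 (\<lambda>_. 1) x + ennreal a * form K (\<lambda>_. 1) g2 x + form K g1 g2 x"
      by (rule form_shift) measurable
    also have "\<dots> \<le> 8 * (ennreal a * ennreal a) + ennreal a * ennreal (l / (4 * a)) + ennreal a * ennreal (l / (4 * a)) + ennreal (l / 4)"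
      by (intro add_mono mult_left_mono n order_refl) auto
    also have "8 * (ennreal a * ennreal a) = ennreal (8 * (a * a))"
      using a by (simp add: ennreal_mult)
    also have "ennreal a * ennreal (l / (4 * a)) = ennreal (l / 4)"
      using a l by (simp flip: ennreal_mult)
    also have "ennreal (8 * (a * a)) + ennreal (l / 4) + ennreal (l / 4) + ennreal (l / 4) = ennreal (8 * (a * a) + l / 4 + l / 4 + l / 4)"
      using a l by (simp flip: ennreal_plus)
    also have "\<dots> \<le> ennreal l" using a2 by (intro ennreal_leI) simp
    finally show False using x by simp
  qed
  then have "emeasure lborel {x. form K (\<lambda>t. ennreal a + g1 t) (\<lambda>t. ennreal a + g2 t) x > ennreal l}
      \<le> emeasure lborel (?S1 \<union> ?S2 \<union> ?S3)"
    by (rule emeasure_mono) measurable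
  also have "\<dots> \<le> emeasure lborel (?S1 \<union> ?S2) + emeasure lborel ?S3"
    by (rule emeasure_subadditive) measurable
  also have "\<dots> \<le> emeasure lborel ?S1 + emeasure lborel ?S2 + emeasure lborel ?S3"
    by (intro add_right_mono emeasure_subadditive) measurable
  also have "\<dots> \<le> ennreal (8 / sqrt l) * ?G1 + ennreal (8 / sqrt l) * ?G2 + ennreal (32 / sqrt l) * (?G1 + ?G2)"
  proof (intro add_mono)
    \<comment> \<open>The left side is \<open>32 * a / l = (256 / 46) / sqrt l\<close>, rounded up
      to \<open>8 / sqrt l\<close>; the quadratic term contributes \<open>32 / sqrt l\<close>,
      together 40.\<close>
    have p: "1 / (l / (4 * a)) * 8 \<le> 8 / sqrt l" "1 / (l / (4 * a)) \<ge> 0"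
      using l a by (auto simp: a_def field_simps)
    have A: "ennreal (1 / (l / (4 * a))) * (8 * G) \<le> ennreal (8 / sqrt l) * G" for G
    proof -
      have "ennreal (1 / (l / (4 * a))) * (8 * G) = ennreal (1 / (l / (4 * a)) * 8) * G"
        using p(2) by (subst ennreal_mult) (auto simp: mult.assoc)
      also have "\<dots> \<le> ennreal (8 / sqrt l) * G"
        by (intro mult_right_mono ennreal_leI p) auto
      finally show ?thesis .
    qed
    have la: "l / (4 * a) > 0" using l a by simp
    have "emeasure lborel ?S1 \<le> ennreal (1 / (l / (4 * a))) * (\<integral>\<^sup>+ x. form K g1 (\<lambda>_. 1) x \<partial>lborel)"
      using markov_ennreal[of "form K g1 (\<lambda>_. 1)" lborel, OF _ la] by simp
    also have "\<dots> \<le> ennreal (1 / (l / (4 * a))) * (8 * ?G1)"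
      by (intro mult_left_mono nn_integral_form_left) auto
    finally show "emeasure lborel ?S1 \<le> ennreal (8 / sqrt l) * ?G1" using A by (rule order_trans)
    have "emeasure lborel ?S2 \<le> ennreal (1 / (l / (4 * a))) * (\<integral>\<^sup>+ x. form K (\<lambda>_. 1) g2 x \<partial>lborel)"
      using markov_ennreal[of "form K (\<lambda>_. 1) g2" lborel, OF _ la] by simp
    also have "\<dots> \<le> ennreal (1 / (l / (4 * a))) * (8 * ?G2)"
      by (intro mult_left_mono nn_integral_form_right) auto
    finally show "emeasure lborel ?S2 \<le> ennreal (8 / sqrt l) * ?G2" using A by (rule order_trans)
    have e: "16 / sqrt (l / 4) = 32 / sqrt l" by (simp add: real_sqrt_divide)
    show "emeasure lborel ?S3 \<le> ennreal (32 / sqrt l) * (?G1 + ?G2)"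
      using emeasure_form_gt[of g1 g2 "l / 4", unfolded e] l by simp
  qed
  also have "\<dots> = ennreal (40 / sqrt l) * (?G1 + ?G2)"
  proof -
    have "ennreal (40 / sqrt l) = ennreal (8 / sqrt l) + ennreal (32 / sqrt l)"
      using l by (simp flip: ennreal_plus)
    then show ?thesis by (simp add: distrib_left distrib_right add_ac)
  qed
  finally show ?thesis by (simp add: a_def)
qed

definition lacunary_form :: "(int \<Rightarrow> real \<times> real \<Rightarrow> ennreal) \<Rightarrow> nat \<Rightarrow> int \<Rightarrow> (real \<Rightarrow> ennreal) \<Rightarrow> (real \<Rightarrow> ennreal) \<Rightarrow> real \<Rightarrow> ennreal" where
  "lacunary_form K \<mu> \<gamma> f1 f2 = form (K \<gamma>) (smooth (\<gamma> - int \<mu>) f1) (smooth (\<gamma> - int \<mu>) f2)"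

lemma lacunary_form_measurable [measurable]:
  assumes [measurable]: "K \<gamma> \<in> borel_measurable borel" "f1 \<in> borel_measurable borel" "f2 \<in> borel_measurable borel"
  shows "lacunary_form K \<mu> \<gamma> f1 f2 \<in> borel_measurable borel"
  unfolding lacunary_form_def by measurable

text \<open>The exceptional sets \<open>E\<close> are removed once for all scales. On the rest every
  scale sees only its own heavy portions, and the additive single-scale bounds sum to a multiple of
  the total heavy mass, at most \<open>\<mu> + 2\<close> for each function.\<close>

lemma weak_type_normalized:
  assumes K: "\<And>\<gamma>. annular_kernel (K \<gamma>) \<gamma>"
    and [measurable]: "f1 \<in> borel_measurable borel" "f2 \<in> borel_measurable borel"
    and f1: "(\<integral>\<^sup>+ t. f1 t \<partial>lborel) \<le> 1" and f2: "(\<integral>\<^sup>+ t. f2 t \<partial>lborel) \<le> 1" and l: "l > 0"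
  shows "emeasure lborel {x. \<exists>\<gamma>. lacunary_form K \<mu> \<gamma> f1 f2 x > ennreal l} \<le> ennreal (2000 * (real \<mu> + 2) / sqrt l)"
proof -
  interpret K: annular_kernel "K \<gamma>" \<gamma> for \<gamma> by (rule K)
  define \<alpha> where "\<alpha> = sqrt l / 46"
  have \<alpha>: "\<alpha> > 0" using l by (simp add: \<alpha>_def)
  define E where "E f = {x. \<exists>j. avg j f x > ennreal (\<alpha> / 2)}" for f
  have E_measurable [measurable]: "E f \<in> sets borel" if [measurable]: "f \<in> borel_measurable borel" for f
  proof -
    have "{x \<in> space borel. \<exists>j. avg j f x > ennreal (\<alpha> / 2)} \<in> sets borel" by measurable
    then show ?thesis by (simp add: E_def)
  qed
  \<comment> \<open>The maximal bound at height \<open>\<alpha> / 2 = sqrt l / 92\<close> gives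
    \<open>10 * 92 = 920\<close>.\<close>
  have E: "emeasure lborel (E f) \<le> ennreal (920 / sqrt l)"
    if "f \<in> borel_measurable borel" "(\<integral>\<^sup>+ t. f t \<partial>lborel) \<le> 1" for f
    using weak_type_maximal[OF that, of "\<alpha> / 2"] \<alpha> by (simp add: E_def \<alpha>_def)
  define h where "h f \<gamma> t = f t * indicator (heavy \<alpha> f (\<gamma> - int \<mu>) (\<gamma> + 2)) t" for f \<gamma> t
  have h_measurable [measurable]: "h f \<gamma> \<in> borel_measurable borel" if [measurable]: "f \<in> borel_measurable borel" for f \<gamma>
    unfolding h_def[abs_def] by measurable
  define g where "g f \<gamma> = smooth (\<gamma> - int \<mu>) (h f \<gamma>)" for f \<gamma>
  have g_measurable [measurable]: "g f \<gamma> \<in> borel_measurable borel" if [measurable]: "f \<in> borel_measurable borel" for f \<gamma>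
    unfolding g_def by measurable
  define S where "S \<gamma> = {x. form (K \<gamma>) (\<lambda>t. ennreal (8 * \<alpha>) + g f1 \<gamma> t) (\<lambda>t. ennreal (8 * \<alpha>) + g f2 \<gamma> t) x > ennreal l}" for \<gamma>
  have [measurable]: "S \<gamma> \<in> sets borel" for \<gamma> unfolding S_def by measurable
  have sub: "{x. \<exists>\<gamma>. lacunary_form K \<mu> \<gamma> f1 f2 x > ennreal l} \<subseteq> E f1 \<union> E f2 \<union> (\<Union>\<gamma>. S \<gamma>)"
  proof
    fix x assume "x \<in> {x. \<exists>\<gamma>. lacunary_form K \<mu> \<gamma> f1 f2 x > ennreal l}"
    then obtain \<gamma> where x: "lacunary_form K \<mu> \<gamma> f1 f2 x > ennreal l" by auto
    show "x \<in> E f1 \<union> E f2 \<union> (\<Union>\<gamma>. S \<gamma>)"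
    proof (rule ccontr)
      assume "\<not> ?thesis"
      then have n: "x \<notin> E f1" "x \<notin> E f2" "x \<notin> S \<gamma>" by auto
      have b: "smooth (\<gamma> - int \<mu>) f u \<le> ennreal (8 * \<alpha>) + g f \<gamma> u"
        if [measurable]: "f \<in> borel_measurable borel" and "x \<notin> E f" "\<bar>x - u\<bar> \<le> 2 powi (\<gamma> + 1)" for f u
        unfolding g_def h_def[abs_def] using that(2,3) \<alpha>
        by (intro smooth_le_heavy[where x=x]) (auto simp: E_def not_less)
      have "lacunary_form K \<mu> \<gamma> f1 f2 x
          \<le> form (K \<gamma>) (\<lambda>t. ennreal (8 * \<alpha>) + g f1 \<gamma> t) (\<lambda>t. ennreal (8 * \<alpha>) + g f2 \<gamma> t) x"
        unfolding lacunary_form_def by (rule K.form_mono) (use n in \<open>auto intro!: b\<close>)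
      with x n(3) show False unfolding S_def by (auto dest: less_le_trans)
    qed
  qed
  have "emeasure lborel {x. \<exists>\<gamma>. lacunary_form K \<mu> \<gamma> f1 f2 x > ennreal l} \<le> emeasure lborel (E f1 \<union> E f2 \<union> (\<Union>\<gamma>. S \<gamma>))"
    by (rule emeasure_mono[OF sub]) measurable
  also have "\<dots> \<le> emeasure lborel (E f1 \<union> E f2) + emeasure lborel (\<Union>\<gamma>. S \<gamma>)"
    by (rule emeasure_subadditive) measurable
  also have "\<dots> \<le> emeasure lborel (E f1) + emeasure lborel (E f2) + emeasure lborel (\<Union>\<gamma>. S \<gamma>)"
    by (intro add_right_mono emeasure_subadditive) measurable
  also have "\<dots> \<le> ennreal (920 / sqrt l) + ennreal (920 / sqrt l) + ennreal (320 * (real \<mu> + 2) / sqrt l)"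
  proof (intro add_mono E f1 f2)
    have "emeasure lborel (\<Union>\<gamma>. S \<gamma>) \<le> (\<integral>\<^sup>+ \<gamma>. emeasure lborel (S \<gamma>) \<partial>count_space UNIV)"
      by (rule emeasure_UN_le_nn_integral) auto
    also have "\<dots> \<le> (\<integral>\<^sup>+ \<gamma>. ennreal (40 / sqrt l) * (4 * (\<integral>\<^sup>+ t. h f1 \<gamma> t \<partial>lborel) + 4 * (\<integral>\<^sup>+ t. h f2 \<gamma> t \<partial>lborel)) \<partial>count_space UNIV)"
    proof (rule nn_integral_mono)
      fix \<gamma>
      have i: "(\<integral>\<^sup>+ t. g f \<gamma> t \<partial>lborel) = 4 * (\<integral>\<^sup>+ t. h f \<gamma> t \<partial>lborel)" if [measurable]: "f \<in> borel_measurable borel" for f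
        unfolding g_def by (rule nn_integral_smooth) measurable
      show "emeasure lborel (S \<gamma>) \<le> ennreal (40 / sqrt l) * (4 * (\<integral>\<^sup>+ t. h f1 \<gamma> t \<partial>lborel) + 4 * (\<integral>\<^sup>+ t. h f2 \<gamma> t \<partial>lborel))"
        using K.emeasure_form_heavy[of "g f1 \<gamma>" "g f2 \<gamma>" l \<gamma>] l by (simp add: S_def \<alpha>_def i)
    qed
    also have "\<dots> = ennreal (40 / sqrt l) * (4 * (\<integral>\<^sup>+ \<gamma>. \<integral>\<^sup>+ t. h f1 \<gamma> t \<partial>lborel \<partial>count_space UNIV)
        + 4 * (\<integral>\<^sup>+ \<gamma>. \<integral>\<^sup>+ t. h f2 \<gamma> t \<partial>lborel \<partial>count_space UNIV))"
      by (simp add: nn_integral_cmult nn_integral_add)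
    also have "\<dots> \<le> ennreal (40 / sqrt l) * (4 * ennreal (real \<mu> + 2) + 4 * ennreal (real \<mu> + 2))"
      unfolding h_def by (intro mult_left_mono add_mono heavy_mass f1 f2) auto
    also have "4 * ennreal (real \<mu> + 2) + 4 * ennreal (real \<mu> + 2) = ennreal (8 * (real \<mu> + 2))"
    proof -
      have *: "4 * ennreal r + 4 * ennreal r = ennreal (8 * r)" if "r \<ge> 0" for r
        using that by (simp add: ennreal_mult flip: distrib_right)
      show ?thesis by (rule *) simp
    qed
    also have "ennreal (40 / sqrt l) * ennreal (8 * (real \<mu> + 2)) = ennreal (320 * (real \<mu> + 2) / sqrt l)"
      using l by (subst ennreal_mult[symmetric]) auto
    finally show "emeasure lborel (\<Union>\<gamma>. S \<gamma>) \<le> ennreal (320 * (real \<mu> + 2) / sqrt l)" .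
  qed measurable
  also have "\<dots> = ennreal (920 / sqrt l + 920 / sqrt l + 320 * (real \<mu> + 2) / sqrt l)"
    using l by (simp flip: ennreal_plus)
  \<comment> \<open>Since \<open>\<mu> + 2 \<ge> 2\<close>, the two exceptional sets, 1840 in total,
    are absorbed into the term proportional to \<open>\<mu> + 2\<close>.\<close>
  also have "\<dots> \<le> ennreal (2000 * (real \<mu> + 2) / sqrt l)"
    using l by (intro ennreal_leI) (simp add: field_simps)
  finally show ?thesis .
qed

subsection \<open>Line integrals of rough kernels\<close>

lemma nn_integral_period_shift:
  fixes h :: "real \<Rightarrow> ennreal"
  assumes [measurable]: "h \<in> borel_measurable borel" and p: "\<And>t. h (t + 2 * pi) = h t"
    and a: "0 \<le> a" "a \<le> 2 * pi"
  shows "(\<integral>\<^sup>+ t. h t * indicator {a..<a + 2 * pi} t \<partial>lborel) = (\<integral>\<^sup>+ t. h t * indicator {0..<2 * pi} t \<partial>lborel)"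
proof -
  have "(\<integral>\<^sup>+ t. h t * indicator {a..<a + 2 * pi} t \<partial>lborel)
      = (\<integral>\<^sup>+ t. h t * indicator {a..<2 * pi} t + h t * indicator {2 * pi..<a + 2 * pi} t \<partial>lborel)"
    using a by (intro nn_integral_cong) (auto split: split_indicator)
  also have "\<dots> = (\<integral>\<^sup>+ t. h t * indicator {a..<2 * pi} t \<partial>lborel) + (\<integral>\<^sup>+ t. h t * indicator {2 * pi..<a + 2 * pi} t \<partial>lborel)"
    by (rule nn_integral_add) auto
  also have "(\<integral>\<^sup>+ t. h t * indicator {2 * pi..<a + 2 * pi} t \<partial>lborel) = (\<integral>\<^sup>+ t. h t * indicator {0..<a} t \<partial>lborel)"
  proof -
    have "(\<integral>\<^sup>+ t. h t * indicator {2 * pi..<a + 2 * pi} t \<partial>lborel)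
        = (\<integral>\<^sup>+ t. h (2 * pi + t) * indicator {2 * pi..<a + 2 * pi} (2 * pi + t) \<partial>lborel)"
      by (rule nn_integral_translate[symmetric]) measurable
    also have "\<dots> = (\<integral>\<^sup>+ t. h t * indicator {0..<a} t \<partial>lborel)"
      by (intro nn_integral_cong) (auto simp: p add.commute split: split_indicator)
    finally show ?thesis .
  qed
  also have "(\<integral>\<^sup>+ t. h t * indicator {a..<2 * pi} t \<partial>lborel) + (\<integral>\<^sup>+ t. h t * indicator {0..<a} t \<partial>lborel)
      = (\<integral>\<^sup>+ t. h t * indicator {a..<2 * pi} t + h t * indicator {0..<a} t \<partial>lborel)"
    by (rule nn_integral_add[symmetric]) auto
  also have "\<dots> = (\<integral>\<^sup>+ t. h t * indicator {0..<2 * pi} t \<partial>lborel)"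
    using a by (intro nn_integral_cong) (auto split: split_indicator)
  finally show ?thesis .
qed

text \<open>This is the substitution \<open>t = c + arctan y\<close>, carried out on compact
  intervals and extended to the line by monotone convergence.\<close>

lemma nn_integral_arctan_le:
  fixes h :: "real \<Rightarrow> ennreal"
  assumes [measurable]: "h \<in> borel_measurable borel"
  shows "(\<integral>\<^sup>+ y. h (c + arctan y) * ennreal (1 / (1 + y\<^sup>2)) \<partial>lborel)
    \<le> (\<integral>\<^sup>+ t. h t * indicator {c - pi / 2..<c + pi / 2} t \<partial>lborel)"
proof -
  let ?f = "\<lambda>y. h (c + arctan y) * ennreal (1 / (1 + y\<^sup>2))"
  have [measurable]: "arctan \<in> borel_measurable borel"
    by (intro borel_measurable_continuous_onI continuous_intros)
  have SUP: "?f y = (SUP n::nat. ?f y * indicator {- (real n + 1)..real n + 1} y)" for y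
  proof (rule antisym)
    obtain n :: nat where "\<bar>y\<bar> \<le> real n" using real_arch_simple by blast
    then have "y \<in> {- (real n + 1)..real n + 1}" by auto
    then have "?f y = ?f y * indicator {- (real n + 1)..real n + 1} y"
      by (simp only: indicator_simps mult_1_right)
    then show "?f y \<le> (SUP n::nat. ?f y * indicator {- (real n + 1)..real n + 1} y)"
      by (metis (no_types, lifting) SUP_upper UNIV_I)
  qed (auto intro!: SUP_least split: split_indicator)
  have "(\<integral>\<^sup>+ y. ?f y \<partial>lborel) = (\<integral>\<^sup>+ y. (SUP n::nat. ?f y * indicator {- (real n + 1)..real n + 1} y) \<partial>lborel)"
    by (subst SUP) simp
  also have "\<dots> = (SUP n::nat. \<integral>\<^sup>+ y. ?f y * indicator {- (real n + 1)..real n + 1} y \<partial>lborel)"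
    by (rule nn_integral_monotone_convergence_SUP)
      (auto simp: incseq_def le_fun_def split: split_indicator)
  also have "\<dots> \<le> (\<integral>\<^sup>+ t. h t * indicator {c - pi / 2..<c + pi / 2} t \<partial>lborel)"
  proof (rule SUP_least)
    fix n :: nat
    let ?b = "real n + 1"
    have "(\<integral>\<^sup>+ y. ?f y * indicator {- ?b..?b} y \<partial>lborel)
        = (\<integral>\<^sup>+ t. h t * indicator {c + arctan (- ?b)..c + arctan ?b} t \<partial>lborel)"
    proof (rule nn_integral_substitution_aux[symmetric])
      show "((\<lambda>y. c + arctan y) has_real_derivative 1 / (1 + y\<^sup>2)) (at y)" for y
        by (auto intro!: derivative_eq_intros simp: inverse_eq_divide)
      have "1 + y\<^sup>2 \<noteq> 0" for y :: real by (metis add_pos_nonneg less_irrefl zero_le_power2 zero_less_one)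
      then show "continuous_on {- ?b..?b} (\<lambda>y. 1 / (1 + y\<^sup>2))"
        by (auto intro!: continuous_intros)
    qed auto
    also have "\<dots> \<le> (\<integral>\<^sup>+ t. h t * indicator {c - pi / 2..<c + pi / 2} t \<partial>lborel)"
      using arctan_lbound[of "- ?b"] arctan_ubound[of ?b]
      by (intro nn_integral_mono) (auto split: split_indicator)
    finally show "(\<integral>\<^sup>+ y. ?f y * indicator {- ?b..?b} y \<partial>lborel)
      \<le> (\<integral>\<^sup>+ t. h t * indicator {c - pi / 2..<c + pi / 2} t \<partial>lborel)" .
  qed
  finally show ?thesis .
qed

lemma norm_pair_real: "norm (a::real, b::real) = sqrt (a\<^sup>2 + b\<^sup>2)"
  by (simp add: norm_Pair)

text \<open>On the line \<open>{(s, s + d)}\<close> arc length is \<open>\<bar>d\<bar> / \<bar>z\<bar>\<^sup>2 ds\<close>, since the line has distance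
  \<open>\<bar>d\<bar> / sqrt 2\<close> from the origin. The line sees an open half circle centred at angle \<open>3 pi / 4\<close> or
  \<open>7 pi / 4\<close>, according to the sign of \<open>d\<close>.\<close>

lemma diagonal_line_integral_le:
  fixes H :: "real \<times> real \<Rightarrow> ennreal"
  assumes [measurable]: "H \<in> borel_measurable borel" and d: "d \<noteq> 0"
  shows "(\<integral>\<^sup>+ s. H ((s, s + d) /\<^sub>R norm (s, s + d)) * ennreal (\<bar>d\<bar> / (norm (s, s + d))\<^sup>2) \<partial>lborel)
    \<le> (\<integral>\<^sup>+ t. H (cos t, sin t) * indicator {0..<2 * pi} t \<partial>lborel)"
proof -
  define h where "h t = H (cos t, sin t)" for t
  have [measurable]: "h \<in> borel_measurable borel" unfolding h_def[abs_def] by measurable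
  have per: "h (t + 2 * pi) = h t" for t by (simp add: h_def)
  define c where "c = (if d > 0 then 3 * pi / 4 else 7 * pi / 4)"
  have cs: "cos c = - sgn d * (sqrt 2 / 2)" "sin c = sgn d * (sqrt 2 / 2)"
  proof -
    have "cos (3 * pi / 4) = - (sqrt 2 / 2)" "sin (3 * pi / 4) = sqrt 2 / 2"
      using cos_diff[of pi "pi / 4"] sin_diff[of pi "pi / 4"] by (simp_all add: cos_45 sin_45)
    moreover have "cos (7 * pi / 4) = sqrt 2 / 2" "sin (7 * pi / 4) = - (sqrt 2 / 2)"
      using cos_diff[of "2 * pi" "pi / 4"] sin_diff[of "2 * pi" "pi / 4"] by (simp_all add: cos_45 sin_45)
    ultimately show "cos c = - sgn d * (sqrt 2 / 2)" "sin c = sgn d * (sqrt 2 / 2)"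
      using d by (auto simp: c_def)
  qed
  \<comment> \<open>The parametrisation \<open>s = - d / 2 - d / 2 * y\<close> starts at the point
    of the line closest to the origin; the negative factor orients the line so that the polar angle
    is exactly \<open>c + arctan y\<close> for both signs of \<open>d\<close>.\<close>
  let ?z = "\<lambda>y. (- d / 2 + - d / 2 * y, - d / 2 + - d / 2 * y + d)"
  let ?G = "\<lambda>s. H ((s, s + d) /\<^sub>R norm (s, s + d)) * ennreal (\<bar>d\<bar> / (norm (s, s + d))\<^sup>2)"
  have nz: "norm (?z y) = \<bar>d\<bar> * (sqrt 2 / 2) * sqrt (1 + y\<^sup>2)" for y
  proof -
    have "(- d / 2 + - d / 2 * y)\<^sup>2 + (- d / 2 + - d / 2 * y + d)\<^sup>2 = d\<^sup>2 * (1 / 2) * (1 + y\<^sup>2)"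
      by (simp add: power2_eq_square field_simps)
    moreover have "sqrt (1 / 2) = sqrt 2 / 2" by (simp add: real_sqrt_divide real_div_sqrt)
    ultimately show ?thesis unfolding norm_pair_real by (simp only: real_sqrt_mult real_sqrt_abs)
  qed
  have pos: "1 + y\<^sup>2 > 0" for y :: real by (simp add: add_pos_nonneg)
  have G: "ennreal \<bar>- d / 2\<bar> * ?G (- d / 2 + - d / 2 * y) = h (c + arctan y) * ennreal (1 / (1 + y\<^sup>2))" for y
  proof -
    have ss: "sqrt 2 * (sqrt 2 * r) = 2 * r" for r by (simp flip: mult.assoc)
    have angle: "?z y /\<^sub>R norm (?z y) = (cos (c + arctan y), sin (c + arctan y))"
      unfolding nz cos_add sin_add cs cos_arctan sin_arctan using d pos[of y]
      by (auto simp: field_simps sgn_if abs_if ss)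
    have density: "\<bar>- d / 2\<bar> * (\<bar>d\<bar> / (norm (?z y))\<^sup>2) = 1 / (1 + y\<^sup>2)"
    proof -
      have n2: "(norm (?z y))\<^sup>2 = d\<^sup>2 * (1 + y\<^sup>2) / 2"
        unfolding nz using pos[of y] by (simp add: power_mult_distrib power_divide)
      have J: "\<bar>- d / 2\<bar> * (\<bar>d\<bar> / q) = d\<^sup>2 / 2 / q" for q
        by (simp add: power2_eq_square)
      show ?thesis unfolding n2 J using d by simp
    qed
    have "ennreal \<bar>- d / 2\<bar> * ?G (- d / 2 + - d / 2 * y)
        = H (?z y /\<^sub>R norm (?z y)) * ennreal (\<bar>- d / 2\<bar> * (\<bar>d\<bar> / (norm (?z y))\<^sup>2))"
      by (subst ennreal_mult) (auto simp only: mult.left_commute abs_ge_zero divide_nonneg_nonneg zero_le_power2)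
    then show ?thesis unfolding angle density h_def .
  qed
  have "(\<integral>\<^sup>+ s. ?G s \<partial>lborel) = ennreal \<bar>- d / 2\<bar> * (\<integral>\<^sup>+ y. ?G (- d / 2 + - d / 2 * y) \<partial>lborel)"
    using d by (intro nn_integral_real_affine) auto
  also have "\<dots> = (\<integral>\<^sup>+ y. ennreal \<bar>- d / 2\<bar> * ?G (- d / 2 + - d / 2 * y) \<partial>lborel)"
    by (rule nn_integral_cmult[symmetric]) measurable
  also have "\<dots> = (\<integral>\<^sup>+ y. h (c + arctan y) * ennreal (1 / (1 + y\<^sup>2)) \<partial>lborel)"
    by (simp only: G)
  also have "\<dots> \<le> (\<integral>\<^sup>+ t. h t * indicator {c - pi / 2..<c + pi / 2} t \<partial>lborel)"
    by (rule nn_integral_arctan_le) measurable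
  \<comment> \<open>Enlarging the half circle to a full period makes the bound the same for every
    \<open>d\<close>; periodicity then moves the window to the one used by
    \<open>arc_length\<close>.\<close>
  also have "\<dots> \<le> (\<integral>\<^sup>+ t. h t * indicator {c - pi / 2..<c - pi / 2 + 2 * pi} t \<partial>lborel)"
    by (intro nn_integral_mono) (auto split: split_indicator)
  also have "\<dots> = (\<integral>\<^sup>+ t. h t * indicator {0..<2 * pi} t \<partial>lborel)"
    by (rule nn_integral_period_shift) (auto simp: per c_def)
  finally show ?thesis unfolding h_def .
qed

definition polar_kernel :: "(real \<times> real \<Rightarrow> ennreal) \<Rightarrow> int \<Rightarrow> real \<times> real \<Rightarrow> ennreal" where
  "polar_kernel H \<gamma> z = H (z /\<^sub>R norm z) * ennreal (1 / (norm z)\<^sup>2) *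
     indicator {z. 2 powi \<gamma> < norm z \<and> norm z \<le> 2 powi (\<gamma> + 1)} z"

lemma polar_kernel_measurable [measurable]:
  assumes [measurable]: "H \<in> borel_measurable borel"
  shows "polar_kernel H \<gamma> \<in> borel_measurable borel"
  unfolding polar_kernel_def[abs_def] by measurable

lemma u1_measurable [measurable]: "u1 \<in> borel_measurable borel"
  unfolding u1_def[abs_def] by measurable

text \<open>The weight enters here: at distance \<open>\<bar>z\<bar> > 2\<^sup>\<gamma>\<close> one has \<open>1 / \<bar>d\<bar> = u1 (z / \<bar>z\<bar>) / \<bar>z\<bar>\<close>.\<close>

lemma polar_kernel_diagonal:
  assumes [measurable]: "H \<in> borel_measurable borel" and d: "d \<noteq> 0"
  shows "(\<integral>\<^sup>+ s. polar_kernel H \<gamma> (s, s + d) \<partial>lborel)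
    \<le> ennreal (2 powi (- \<gamma>)) * (\<integral>\<^sup>+ t. H (cos t, sin t) * u1 (cos t, sin t) * indicator {0..<2 * pi} t \<partial>lborel)"
proof -
  let ?n = "\<lambda>s. (s, s + d) /\<^sub>R norm (s, s + d)"
  let ?J = "\<lambda>s. ennreal (\<bar>d\<bar> / (norm (s, s + d))\<^sup>2)"
  have le: "polar_kernel H \<gamma> (s, s + d) \<le> ennreal (2 powi (- \<gamma>)) * (H (?n s) * u1 (?n s) * ?J s)" for s
  proof (cases "2 powi \<gamma> < norm (s, s + d)")
    case True
    let ?r = "norm (s, s + d)"
    have g: "(2::real) powi \<gamma> > 0" by simp
    have r: "?r > 0" using True g by linarith
    have "u1 (?n s) = inverse (ennreal (\<bar>d\<bar> / ?r))"
    proof -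
      have "\<bar>fst (?n s) - snd (?n s)\<bar> = \<bar>d\<bar> / ?r"
      proof -
        have "fst (?n s) - snd (?n s) = - d * inverse ?r" by (simp add: algebra_simps)
        then show ?thesis by (simp add: abs_mult divide_inverse)
      qed
      then show ?thesis by (simp add: u1_def)
    qed
    also have "\<dots> = ennreal (?r / \<bar>d\<bar>)"
      using r d by (subst inverse_ennreal) auto
    finally have u: "u1 (?n s) = ennreal (?r / \<bar>d\<bar>)" .
    have "1 / ?r\<^sup>2 \<le> 2 powi (- \<gamma>) * (?r / \<bar>d\<bar> * (\<bar>d\<bar> / ?r\<^sup>2))"
    proof -
      have "1 \<le> 2 powi (- \<gamma>) * ?r"
        using True g by (simp add: power_int_minus field_simps)
      then have "1 * (1 / ?r\<^sup>2) \<le> (2 powi (- \<gamma>) * ?r) * (1 / ?r\<^sup>2)"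
        by (intro mult_right_mono) auto
      then show ?thesis using d by (simp add: mult.assoc)
    qed
    then have "ennreal (1 / ?r\<^sup>2) \<le> ennreal (2 powi (- \<gamma>)) * (u1 (?n s) * ?J s)"
      unfolding u using r by (subst ennreal_mult[symmetric]; (subst ennreal_mult[symmetric])?) (auto intro!: ennreal_leI)
    then have "H (?n s) * ennreal (1 / ?r\<^sup>2) \<le> H (?n s) * (ennreal (2 powi (- \<gamma>)) * (u1 (?n s) * ?J s))"
      by (rule mult_left_mono) simp
    moreover have "polar_kernel H \<gamma> (s, s + d) \<le> H (?n s) * ennreal (1 / ?r\<^sup>2)"
      unfolding polar_kernel_def by (auto split: split_indicator)
    ultimately show ?thesis by (simp add: mult_ac)
  next
    case False
    then show ?thesis by (simp add: polar_kernel_def)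
  qed
  have "(\<integral>\<^sup>+ s. polar_kernel H \<gamma> (s, s + d) \<partial>lborel)
      \<le> (\<integral>\<^sup>+ s. ennreal (2 powi (- \<gamma>)) * (H (?n s) * u1 (?n s) * ?J s) \<partial>lborel)"
    by (intro nn_integral_mono le)
  also have "\<dots> = ennreal (2 powi (- \<gamma>)) * (\<integral>\<^sup>+ s. H (?n s) * u1 (?n s) * ?J s \<partial>lborel)"
    by (rule nn_integral_cmult) measurable
  also have "\<dots> \<le> ennreal (2 powi (- \<gamma>)) * (\<integral>\<^sup>+ t. H (cos t, sin t) * u1 (cos t, sin t) * indicator {0..<2 * pi} t \<partial>lborel)"
    using diagonal_line_integral_le[of "\<lambda>z. H z * u1 z" d] d by (intro mult_left_mono) auto
  finally show ?thesis .
qed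

lemma annular_kernel_polar:
  assumes [measurable]: "H \<in> borel_measurable borel" and B: "B > 0"
    and H: "(\<integral>\<^sup>+ t. H (cos t, sin t) * u1 (cos t, sin t) * indicator {0..<2 * pi} t \<partial>lborel) \<le> ennreal B"
  shows "annular_kernel (\<lambda>z. ennreal (1 / B) * polar_kernel H \<gamma> z) \<gamma>"
proof
  show "(\<lambda>z. ennreal (1 / B) * polar_kernel H \<gamma> z) \<in> borel_measurable borel" by measurable
next
  fix z :: "real \<times> real" assume "ennreal (1 / B) * polar_kernel H \<gamma> z \<noteq> 0"
  then have "norm z \<le> 2 powi (\<gamma> + 1)"
    by (auto simp: polar_kernel_def indicator_def split: if_splits)
  then show "\<bar>fst z\<bar> \<le> 2 powi (\<gamma> + 1) \<and> \<bar>snd z\<bar> \<le> 2 powi (\<gamma> + 1)"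
    using norm_fst_le[of "fst z" "snd z"] norm_snd_le[of "snd z" "fst z"] by auto
next
  fix d :: real assume d: "d \<noteq> 0"
  have "(\<integral>\<^sup>+ s. ennreal (1 / B) * polar_kernel H \<gamma> (s, s + d) \<partial>lborel)
      = ennreal (1 / B) * (\<integral>\<^sup>+ s. polar_kernel H \<gamma> (s, s + d) \<partial>lborel)"
    by (rule nn_integral_cmult) measurable
  also have "\<dots> \<le> ennreal (1 / B) * (ennreal (2 powi (- \<gamma>)) * ennreal B)"
    using polar_kernel_diagonal[OF assms(1) d, of \<gamma>] H by (intro mult_left_mono) (auto elim!: order_trans intro: mult_left_mono)
  also have "\<dots> = ennreal (2 powi (- \<gamma>))"
    using B by (simp add: mult.left_commute flip: ennreal_mult)
  finally show "(\<integral>\<^sup>+ s. ennreal (1 / B) * polar_kernel H \<gamma> (s, s + d) \<partial>lborel) \<le> ennreal (2 powi - \<gamma>)" .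
qed

text \<open>A function measurable for the completed arc length is only almost everywhere Borel. A
  majorant valid at every point of the circle avoids translating null sets of the circle into null
  sets of the plane.\<close>

lemma borel_majorant_arc_length:
  assumes \<Omega>: "\<Omega> \<in> borel_measurable arc_length"
  obtains H :: "real \<times> real \<Rightarrow> ennreal" where "H \<in> borel_measurable borel"
    "\<And>z. norm z = 1 \<Longrightarrow> ennreal (norm (\<Omega> z)) \<le> H z"
    "(\<integral>\<^sup>+ t. H (cos t, sin t) * u1 (cos t, sin t) * indicator {0..<2 * pi} t \<partial>lborel) = L1_u1_norm \<Omega>"
proof -
  let ?c = "\<lambda>t::real. (cos t, sin t)"
  let ?I = "restrict_space lborel {0..<2 * pi} :: real measure"
  let ?S = "restrict_space borel (sphere 0 1) :: (real \<times> real) measure"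
  define N where "N = distr ?I ?S ?c"
  have arc: "arc_length = completion N" by (simp add: arc_length_def N_def)
  have c [measurable]: "?c \<in> ?I \<rightarrow>\<^sub>M ?S"
    by (rule measurable_restrict_space2) (auto simp: norm_pair_real intro!: measurable_restrict_space1)
  have spN: "space N = sphere 0 1" by (simp add: N_def space_restrict_space)
  have "(\<lambda>z. ennreal (norm (\<Omega> z))) \<in> borel_measurable (completion N)"
    using \<Omega> unfolding arc by measurable
  then obtain g where g [measurable]: "g \<in> borel_measurable N" and ae: "AE z in N. ennreal (norm (\<Omega> z)) = g z"
    using completion_ex_borel_measurable by blast
  then obtain Z where Z: "{z \<in> space N. ennreal (norm (\<Omega> z)) \<noteq> g z} \<subseteq> Z" "emeasure N Z = 0" "Z \<in> sets N"
    by (auto elim: AE_E)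
  \<comment> \<open>The value \<open>\<infinity>\<close> dominates anything on the exceptional set,
    and that set is null, so the weighted integral does not change.\<close>
  define H0 where "H0 z = (if z \<in> Z then \<infinity> else g z)" for z
  have H0 [measurable]: "H0 \<in> borel_measurable N"
    unfolding H0_def[abs_def] using Z(3) by measurable
  define H where "H z = H0 z * indicator (sphere 0 1) z" for z
  have [measurable]: "H \<in> borel_measurable borel"
  proof -
    have "H0 \<in> borel_measurable ?S" using H0 by (simp add: N_def)
    then show ?thesis
      unfolding H_def[abs_def] by (subst (asm) borel_measurable_restrict_space_iff_ennreal) auto
  qed
  have ae': "AE z in N. ennreal (norm (\<Omega> z)) = H0 z"
  proof -
    have "AE z in N. z \<notin> Z" using Z by (intro AE_not_in) auto
    then show ?thesis using ae by eventually_elim (simp add: H0_def)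
  qed
  have "L1_u1_norm \<Omega> = (\<integral>\<^sup>+ z. ennreal (norm (\<Omega> z)) * u1 z \<partial>N)"
    by (simp add: L1_u1_norm_def arc nn_integral_completion)
  also have "\<dots> = (\<integral>\<^sup>+ z. H0 z * u1 z \<partial>N)"
    by (intro nn_integral_cong_AE) (use ae' in eventually_elim, simp)
  also have "\<dots> = (\<integral>\<^sup>+ t. H0 (?c t) * u1 (?c t) \<partial>?I)"
  proof -
    have "u1 \<in> borel_measurable ?S" by (intro measurable_restrict_space1) measurable
    moreover have "H0 \<in> borel_measurable ?S" using H0 by (simp add: N_def)
    ultimately show ?thesis unfolding N_def by (subst nn_integral_distr) auto
  qed
  also have "\<dots> = (\<integral>\<^sup>+ t. H0 (?c t) * u1 (?c t) * indicator {0..<2 * pi} t \<partial>lborel)"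
    by (rule nn_integral_restrict_space) auto
  also have "\<dots> = (\<integral>\<^sup>+ t. H (?c t) * u1 (?c t) * indicator {0..<2 * pi} t \<partial>lborel)"
    by (simp add: H_def norm_pair_real indicator_def)
  finally have I: "(\<integral>\<^sup>+ t. H (?c t) * u1 (?c t) * indicator {0..<2 * pi} t \<partial>lborel) = L1_u1_norm \<Omega>" ..
  have "ennreal (norm (\<Omega> z)) \<le> H z" if "norm z = 1" for z
    using Z(1) that by (auto simp: H_def H0_def spN)
  from that[OF _ this I] show ?thesis by simp
qed

subsection \<open>Passage to the operators\<close>

lemma schwartz_continuous: "schwartz f \<Longrightarrow> continuous_on UNIV f"
  unfolding schwartz_def
  by (auto simp: continuous_on_eq_continuous_at dest!: spec[of _ "[]"] intro!: differentiable_imp_continuous_within)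

lemma schwartz_measurable: "schwartz f \<Longrightarrow> f \<in> borel_measurable borel"
  by (intro borel_measurable_continuous_onI schwartz_continuous)

lemma schwartz_decay:
  assumes "schwartz f"
  obtains B where "B > 0" "\<And>x. norm (f x) * (1 + norm x ^ k) \<le> B"
proof -
  have "\<exists>B. \<forall>x. norm x ^ k * norm (f x) \<le> B" for k :: nat
    using assms unfolding schwartz_def by (auto dest!: spec[of _ "[]"])
  then obtain B0 B1 where B: "norm x ^ 0 * norm (f x) \<le> B0" "norm x ^ k * norm (f x) \<le> B1" for x
    by metis
  have "norm (f x) * (1 + norm x ^ k) \<le> \<bar>B0\<bar> + \<bar>B1\<bar> + 1" for x
    using B[of x] by (simp add: algebra_simps)
  then show thesis by (intro that[of "\<bar>B0\<bar> + \<bar>B1\<bar> + 1"]) auto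
qed

text \<open>Finite norms can be replaced by real numbers, which the final limiting argument
  needs.\<close>

lemma schwartz_L1_norm_finite:
  fixes f :: "real \<Rightarrow> complex"
  assumes "schwartz f"
  shows "L1_norm f < \<infinity>"
proof -
  obtain B where B: "B > 0" "norm (f x) * (1 + norm x ^ 2) \<le> B" for x
    using schwartz_decay[OF assms] by metis
  have "ennreal (norm (f t)) \<le> ennreal B * (4 * bump 0 t)" for t
  proof -
    have "norm (f t) \<le> B * (1 / (1 + t\<^sup>2))"
      using B(2)[of t] by (simp add: field_simps add_pos_nonneg)
    then have "ennreal (norm (f t)) \<le> ennreal (B * (1 / (1 + t\<^sup>2)))" by (rule ennreal_leI)
    also have "\<dots> = ennreal B * ennreal (1 / (1 + t\<^sup>2))" using B(1) by (intro ennreal_mult) auto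
    also have "\<dots> \<le> ennreal B * (4 * bump 0 t)" by (intro mult_left_mono bump_ge) auto
    finally show ?thesis .
  qed
  then have "L1_norm f \<le> (\<integral>\<^sup>+ t. ennreal B * (4 * bump 0 t) \<partial>lborel)"
    unfolding L1_norm_def nn_integral_completion by (intro nn_integral_mono)
  also have "\<dots> = ennreal B * (4 * 4)"
    by (simp add: nn_integral_cmult nn_integral_bump)
  also have "\<dots> < \<infinity>" by (simp add: ennreal_mult_less_top)
  finally show ?thesis .
qed

text \<open>Decay of order four in the plane dominates decay of order two in each coordinate
  separately, because \<open>(1 + a^2) * (1 + b^2) \<le> 2 * (1 + \<bar>w\<bar>^4)\<close> for
  \<open>w = (a, b)\<close>. A tensor product majorant is what allows the convolution to act on
  \<open>f1\<close> and \<open>f2\<close> individually.\<close>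

lemma schwartz_dilation_le_bump:
  assumes "schwartz \<Psi>"
  obtains B where "B > 0" "\<And>k w. ennreal (norm (dyadic_dilation \<Psi> (- k) w)) \<le> ennreal B * (bump k (fst w) * bump k (snd w))"
proof -
  obtain B where B: "B > 0" "norm (\<Psi> w) * (1 + norm w ^ 4) \<le> B" for w
    using schwartz_decay[OF assms] by metis
  have 1: "ennreal (norm (\<Psi> w)) \<le> ennreal (32 * B) * (bump 0 (fst w) * bump 0 (snd w))" for w
  proof -
    let ?a = "1 + (fst w)\<^sup>2" and ?b = "1 + (snd w)\<^sup>2"
    have ab: "?a > 0" "?b > 0" by (simp_all add: add_pos_nonneg)
    have n: "norm w ^ 2 = (fst w)\<^sup>2 + (snd w)\<^sup>2" by (cases w) (simp add: norm_pair_real)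
    have "?a * ?b \<le> (1 + norm w ^ 2) * (1 + norm w ^ 2)"
      unfolding n by (intro mult_mono) auto
    also have "\<dots> \<le> 2 * (1 + norm w ^ 4)"
    proof -
      have "norm w ^ 4 = (norm w ^ 2)\<^sup>2" by simp
      then show ?thesis using sum_squares_bound[of 1 "norm w ^ 2"] by (simp add: algebra_simps power2_eq_square)
    qed
    finally have "norm (\<Psi> w) * (?a * ?b) \<le> norm (\<Psi> w) * (2 * (1 + norm w ^ 4))"
      by (rule mult_left_mono) simp
    also have "\<dots> \<le> 2 * B" using B(2)[of w] by (subst mult.left_commute) simp
    finally have bound: "norm (\<Psi> w) * (?a * ?b) \<le> 2 * B" .
    have "norm (\<Psi> w) \<le> 2 * B * (1 / ?a * (1 / ?b))"
    proof -
      have "norm (\<Psi> w) \<le> 2 * B / (?a * ?b)"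
        using bound ab by (subst pos_le_divide_eq) (auto intro: mult_pos_pos)
      then show ?thesis by (simp only: times_divide_eq_right times_divide_eq_left mult_1_right divide_divide_eq_left)
    qed
    then have "ennreal (norm (\<Psi> w)) \<le> ennreal (2 * B * (1 / ?a * (1 / ?b)))" by (rule ennreal_leI)
    also have "\<dots> = ennreal (2 * B) * (ennreal (1 / ?a) * ennreal (1 / ?b))"
      using ab B(1) by (subst ennreal_mult[symmetric]; (subst ennreal_mult[symmetric])?) auto
    also have "\<dots> \<le> ennreal (2 * B) * ((4 * bump 0 (fst w)) * (4 * bump 0 (snd w)))"
      by (intro mult_left_mono mult_mono bump_ge) auto
    also have "\<dots> = (ennreal (2 * B) * 16) * (bump 0 (fst w) * bump 0 (snd w))"
      by (simp add: mult_ac)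
    also have "ennreal (2 * B) * 16 = ennreal (2 * B * 16)"
      using B(1) by (subst ennreal_mult) auto
    finally show ?thesis by simp
  qed
  have "ennreal (norm (dyadic_dilation \<Psi> (- k) w)) \<le> ennreal (32 * B) * (bump k (fst w) * bump k (snd w))" for k w
  proof -
    have "ennreal (norm (dyadic_dilation \<Psi> (- k) w))
        = ennreal (2 powi (- k)) * ennreal (2 powi (- k)) * ennreal (norm (\<Psi> ((2 powi (- k)) *\<^sub>R w)))"
      unfolding dyadic_dilation_def
      by (simp add: norm_mult norm_power_int flip: ennreal_mult power_int_add)
    also have "\<dots> \<le> ennreal (2 powi (- k)) * ennreal (2 powi (- k))
        * (ennreal (32 * B) * (bump 0 (fst ((2 powi (- k)) *\<^sub>R w)) * bump 0 (snd ((2 powi (- k)) *\<^sub>R w))))"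
      by (intro mult_left_mono 1) auto
    also have "\<dots> = ennreal (32 * B) * ((ennreal (2 powi (- k)) * bump 0 (2 powi (- k) * fst w)) * (ennreal (2 powi (- k)) * bump 0 (2 powi (- k) * snd w)))"
      by (simp add: mult_ac)
    also have "\<dots> = ennreal (32 * B) * (bump k (fst w) * bump k (snd w))"
      by (simp only: bump_scale)
    finally show ?thesis .
  qed
  then show thesis using B(1) by (intro that[of "32 * B"]) auto
qed

text \<open>The integral of a non-integrable function is 0 by convention, so the bound covers
  whatever integrands occur in \<open>convolution\<close> and \<open>L_op\<close>.\<close>

lemma norm_integral_le_nn_integral:
  fixes f :: "'a \<Rightarrow> 'b::{banach, second_countable_topology}"
  shows "ennreal (norm (integral\<^sup>L M f)) \<le> (\<integral>\<^sup>+ x. ennreal (norm (f x)) \<partial>M)"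
proof (cases "integrable M f")
  case True
  then show ?thesis by (rule integral_norm_bound_ennreal)
qed (simp add: not_integrable_integral_eq)

text \<open>On the annulus only the terms \<open>\<gamma> = 1, 2\<close> of the series defining \<open>Phi_hat\<close> survive.\<close>

lemma Phi_hat_bound:
  assumes supp: "closure {\<xi>. fourier \<Psi> \<xi> \<noteq> 0} \<subseteq> {\<xi>. 1 / 2 \<le> norm \<xi> \<and> norm \<xi> \<le> 2}"
    and y: "norm y \<le> 2"
  shows "norm (Phi_hat \<Psi> y) \<le> 1 + 2 * (LINT x|lebesgue. norm (\<Psi> x))"
proof -
  let ?J = "LINT x|lebesgue. norm (\<Psi> x)"
  have F: "norm (fourier \<Psi> \<xi>) \<le> ?J" for \<xi>
  proof -
    have "norm (fourier \<Psi> \<xi>) \<le> (LINT x|lebesgue. norm (cis (- 2 * pi * (x \<bullet> \<xi>)) * \<Psi> x))"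
      unfolding fourier_def by (rule integral_norm_bound)
    then show ?thesis by (simp add: norm_mult)
  qed
  have zero: "fourier \<Psi> ((2 powi (- \<gamma>)) *\<^sub>R y) = 0" if "\<gamma> \<ge> 3" for \<gamma> :: int
  proof (rule ccontr)
    assume "\<not> ?thesis"
    then have "(2 powi (- \<gamma>)) *\<^sub>R y \<in> {\<xi>. fourier \<Psi> \<xi> \<noteq> 0}" by simp
    then have "(2 powi (- \<gamma>)) *\<^sub>R y \<in> {\<xi>. 1 / 2 \<le> norm \<xi> \<and> norm \<xi> \<le> 2}"
      by (rule subsetD[OF order_trans[OF closure_subset supp]])
    then have "1 / 2 \<le> norm ((2 powi (- \<gamma>)) *\<^sub>R y)" by (simp only: mem_Collect_eq)
    also have "\<dots> = 2 powi (- \<gamma>) * norm y" by (simp only: norm_scaleR) simp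
    also have "\<dots> \<le> 2 powi (- 3) * 2"
      using that y by (intro mult_mono power_int_increasing) auto
    finally show False by (simp add: power_int_minus)
  qed
  let ?F = "\<lambda>\<gamma>::int. fourier \<Psi> ((2 powi (- \<gamma>)) *\<^sub>R y)"
  have "infsum ?F {1..} = infsum ?F {1, 2}"
  proof (rule infsum_cong_neutral)
    show "?F \<gamma> = 0" if "\<gamma> \<in> {1..} - {1, 2}" for \<gamma>
      by (rule zero) (use that in auto)
  qed auto
  also have "\<dots> = sum ?F {1, 2}"
    by (rule infsum_finite) simp
  also have "\<dots> = ?F 1 + ?F 2"
    by (subst sum.insert) auto
  finally have "Phi_hat \<Psi> y = 1 - (?F 1 + ?F 2)"
    unfolding Phi_hat_def by (rule arg_cong)
  then have "norm (Phi_hat \<Psi> y) \<le> norm (1::complex) + norm (?F 1 + ?F 2)"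
    by (simp only: norm_triangle_ineq4)
  also have "norm (?F 1 + ?F 2) \<le> norm (?F 1) + norm (?F 2)"
    by (rule norm_triangle_ineq)
  also have "norm (?F 1) + norm (?F 2) \<le> ?J + ?J"
    by (intro add_mono F)
  finally show ?thesis by simp
qed

lemma norm_K_star_le:
  assumes supp: "closure {\<xi>. fourier \<Psi> \<xi> \<noteq> 0} \<subseteq> {\<xi>. 1 / 2 \<le> norm \<xi> \<and> norm \<xi> \<le> 2}"
    and H: "\<And>z. norm z = 1 \<Longrightarrow> ennreal (norm (\<Omega> z)) \<le> H z"
  shows "ennreal (norm (K_star \<Psi> \<Omega> \<gamma> z)) \<le> ennreal (1 + 2 * (LINT x|lebesgue. norm (\<Psi> x))) * polar_kernel H \<gamma> z"
proof (cases "2 powi \<gamma> < norm z \<and> norm z \<le> 2 powi (\<gamma> + 1)")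
  case True
  let ?C = "1 + 2 * (LINT x|lebesgue. norm (\<Psi> x))"
  have C: "?C \<ge> 0" by (simp add: add_nonneg_nonneg integral_nonneg)
  have g: "(2::real) powi \<gamma> > 0" by simp
  have z: "norm z > 0" using True g by linarith
  have "2 powi (- \<gamma>) * norm z \<le> 2"
    using True g by (simp add: power_int_minus power_int_add field_simps)
  then have P: "norm (Phi_hat \<Psi> ((2 powi (- \<gamma>)) *\<^sub>R z)) \<le> ?C"
    by (intro Phi_hat_bound[OF supp]) simp
  have "ennreal (norm (K_star \<Psi> \<Omega> \<gamma> z))
      = ennreal (norm (\<Omega> (z /\<^sub>R norm z))) * (ennreal (1 / (norm z)\<^sup>2) * ennreal (norm (Phi_hat \<Psi> ((2 powi (- \<gamma>)) *\<^sub>R z))))"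
    using True by (simp add: K_star_def rough_kernel_def norm_mult norm_divide norm_power flip: ennreal_mult)
  also have "\<dots> \<le> H (z /\<^sub>R norm z) * (ennreal (1 / (norm z)\<^sup>2) * ennreal ?C)"
    using z by (intro mult_mono mult_left_mono H ennreal_leI P) auto
  also have "\<dots> = ennreal ?C * polar_kernel H \<gamma> z"
    using True by (simp add: polar_kernel_def mult_ac)
  finally show ?thesis .
next
  case False
  then show ?thesis by (simp add: K_star_def)
qed

text \<open>This moves the convolution off the rough kernel: the majorant of the dilated
  \<open>\<Psi>\<close> factors, and the integral over \<open>y\<close> becomes two one-dimensional
  smoothings evaluated at the kernel variable \<open>z\<close>.\<close>

lemma nn_integral_bump_product:
  assumes [measurable]: "F1 \<in> borel_measurable borel" "F2 \<in> borel_measurable borel"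
  shows "(\<integral>\<^sup>+ y. bump k (fst y - fst z) * bump k (snd y - snd z) * (F1 (x - fst y) * F2 (x - snd y)) \<partial>lborel)
    = smooth k F1 (x - fst z) * smooth k F2 (x - snd z)"
proof -
  have sm: "(\<integral>\<^sup>+ s. bump k (s - c) * F (x - s) \<partial>lborel) = smooth k F (x - c)"
    if [measurable]: "F \<in> borel_measurable borel" for F c
    using nn_integral_reflect[of "\<lambda>t. bump k (x - c - t) * F t" x]
    by (simp add: smooth_def algebra_simps)
  have "(\<lambda>y. bump k (fst y - fst z) * bump k (snd y - snd z) * (F1 (x - fst y) * F2 (x - snd y))) \<in> borel_measurable borel"
    by measurable
  from nn_integral_plane[OF this]
  have "(\<integral>\<^sup>+ y. bump k (fst y - fst z) * bump k (snd y - snd z) * (F1 (x - fst y) * F2 (x - snd y)) \<partial>lborel)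
      = (\<integral>\<^sup>+ s. \<integral>\<^sup>+ t. (bump k (s - fst z) * F1 (x - s)) * (bump k (t - snd z) * F2 (x - t)) \<partial>lborel \<partial>lborel)"
    by (simp add: mult_ac)
  also have "\<dots> = (\<integral>\<^sup>+ s. (bump k (s - fst z) * F1 (x - s)) * smooth k F2 (x - snd z) \<partial>lborel)"
    by (intro nn_integral_cong) (simp add: nn_integral_cmult sm)
  also have "\<dots> = (\<integral>\<^sup>+ s. bump k (s - fst z) * F1 (x - s) \<partial>lborel) * smooth k F2 (x - snd z)"
    by (rule nn_integral_multc) measurable
  finally show ?thesis by (simp add: sm)
qed

text \<open>Absolute values are taken inside both integrals and the \<open>y\<close> integral is
  done first. The dilation of index \<open>\<mu> - \<gamma>\<close> has width
  \<open>2 powi (\<gamma> - \<mu>)\<close>, which is the scale of the smoothing; the constant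
  depends on \<open>\<Psi>\<close> alone.\<close>

lemma norm_L_op_le:
  assumes \<Psi>: "schwartz \<Psi>"
    and supp: "closure {\<xi>. fourier \<Psi> \<xi> \<noteq> 0} \<subseteq> {\<xi>. 1 / 2 \<le> norm \<xi> \<and> norm \<xi> \<le> 2}"
  obtains C where "C > 0"
    "\<And>\<Omega> H \<mu> \<gamma> f1 f2 x. H \<in> borel_measurable borel \<Longrightarrow> (\<And>z. norm z = 1 \<Longrightarrow> ennreal (norm (\<Omega> z)) \<le> H z) \<Longrightarrow>
      schwartz f1 \<Longrightarrow> schwartz f2 \<Longrightarrow>
      ennreal (norm (L_op \<Psi> \<Omega> \<mu> \<gamma> f1 f2 x)) \<le> ennreal C *
        form (polar_kernel H \<gamma>) (smooth (\<gamma> - \<mu>) (\<lambda>t. ennreal (norm (f1 t)))) (smooth (\<gamma> - \<mu>) (\<lambda>t. ennreal (norm (f2 t)))) x"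
proof -
  obtain B where B: "B > 0" "\<And>k w. ennreal (norm (dyadic_dilation \<Psi> (- k) w)) \<le> ennreal B * (bump k (fst w) * bump k (snd w))"
    using schwartz_dilation_le_bump[OF \<Psi>] by blast
  define D where "D = 1 + 2 * (LINT x|lebesgue. norm (\<Psi> x))"
  have D: "D > 0" by (simp add: D_def add_pos_nonneg integral_nonneg)
  show thesis
  proof (rule that[of "B * D"])
    show "B * D > 0" using B D by simp
  next
    fix \<Omega> :: "real \<times> real \<Rightarrow> complex" and H :: "real \<times> real \<Rightarrow> ennreal" and \<mu> \<gamma> :: int and f1 f2 :: "real \<Rightarrow> complex" and x :: real
    assume H [measurable]: "H \<in> borel_measurable borel" and \<Omega>: "\<And>z. norm z = 1 \<Longrightarrow> ennreal (norm (\<Omega> z)) \<le> H z"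
      and "schwartz f1" "schwartz f2"
    then have [measurable]: "f1 \<in> borel_measurable borel" "f2 \<in> borel_measurable borel"
      by (auto intro: schwartz_measurable)
    define k where "k = \<gamma> - \<mu>"
    define F1 where "F1 t = ennreal (norm (f1 t))" for t
    define F2 where "F2 t = ennreal (norm (f2 t))" for t
    have [measurable]: "F1 \<in> borel_measurable borel" "F2 \<in> borel_measurable borel"
      unfolding F1_def[abs_def] F2_def[abs_def] by measurable
    let ?P = "polar_kernel H \<gamma>"
    have conv: "ennreal (norm (convolution (dyadic_dilation \<Psi> (\<mu> - \<gamma>)) (K_star \<Psi> \<Omega> \<gamma>) y))
        \<le> (\<integral>\<^sup>+ z. ennreal (B * D) * (?P z * (bump k (fst y - fst z) * bump k (snd y - snd z))) \<partial>lborel)" for y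
    proof -
      have "ennreal (norm (convolution (dyadic_dilation \<Psi> (\<mu> - \<gamma>)) (K_star \<Psi> \<Omega> \<gamma>) y))
          \<le> (\<integral>\<^sup>+ z. ennreal (norm (dyadic_dilation \<Psi> (\<mu> - \<gamma>) (y - z) * K_star \<Psi> \<Omega> \<gamma> z)) \<partial>lebesgue)"
        unfolding convolution_def by (rule norm_integral_le_nn_integral)
      also have "\<dots> \<le> (\<integral>\<^sup>+ z. ennreal (B * D) * (?P z * (bump k (fst y - fst z) * bump k (snd y - snd z))) \<partial>lebesgue)"
      proof (rule nn_integral_mono)
        fix z
        have "ennreal (norm (dyadic_dilation \<Psi> (\<mu> - \<gamma>) (y - z) * K_star \<Psi> \<Omega> \<gamma> z))
            = ennreal (norm (dyadic_dilation \<Psi> (- k) (y - z))) * ennreal (norm (K_star \<Psi> \<Omega> \<gamma> z))"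
          by (simp add: norm_mult ennreal_mult k_def)
        also have "\<dots> \<le> (ennreal B * (bump k (fst (y - z)) * bump k (snd (y - z)))) * (ennreal D * ?P z)"
          unfolding D_def by (intro mult_mono B norm_K_star_le supp \<Omega>) auto
        also have "\<dots> = ennreal (B * D) * (?P z * (bump k (fst y - fst z) * bump k (snd y - snd z)))"
          using B(1) D by (simp add: ennreal_mult mult_ac)
        finally show "ennreal (norm (dyadic_dilation \<Psi> (\<mu> - \<gamma>) (y - z) * K_star \<Psi> \<Omega> \<gamma> z))
          \<le> ennreal (B * D) * (?P z * (bump k (fst y - fst z) * bump k (snd y - snd z)))" .
      qed
      finally show ?thesis by (simp add: nn_integral_completion)
    qed
    have "ennreal (norm (L_op \<Psi> \<Omega> \<mu> \<gamma> f1 f2 x))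
        \<le> (\<integral>\<^sup>+ y. ennreal (norm (convolution (dyadic_dilation \<Psi> (\<mu> - \<gamma>)) (K_star \<Psi> \<Omega> \<gamma>) y * f1 (x - fst y) * f2 (x - snd y))) \<partial>lebesgue)"
      unfolding L_op_def by (rule norm_integral_le_nn_integral)
    also have "\<dots> \<le> (\<integral>\<^sup>+ y. (\<integral>\<^sup>+ z. ennreal (B * D) * (?P z * (bump k (fst y - fst z) * bump k (snd y - snd z))) \<partial>lborel)
        * (F1 (x - fst y) * F2 (x - snd y)) \<partial>lebesgue)"
      by (rule nn_integral_mono) (simp add: norm_mult ennreal_mult F1_def F2_def mult.assoc mult_right_mono conv)
    also have "\<dots> = (\<integral>\<^sup>+ y. \<integral>\<^sup>+ z. ennreal (B * D) * (?P z * (bump k (fst y - fst z) * bump k (snd y - snd z)))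
        * (F1 (x - fst y) * F2 (x - snd y)) \<partial>lborel \<partial>lborel)"
      unfolding nn_integral_completion by (intro nn_integral_cong nn_integral_multc[symmetric]) measurable
    also have "\<dots> = (\<integral>\<^sup>+ z. \<integral>\<^sup>+ y. ennreal (B * D) * (?P z * (bump k (fst y - fst z) * bump k (snd y - snd z)))
        * (F1 (x - fst y) * F2 (x - snd y)) \<partial>lborel \<partial>lborel)"
      by (rule lborel_pair.Fubini') measurable
    also have "\<dots> = (\<integral>\<^sup>+ z. ennreal (B * D) * (?P z * (smooth k F1 (x - fst z) * smooth k F2 (x - snd z))) \<partial>lborel)"
    proof (rule nn_integral_cong)
      fix z
      have "(\<integral>\<^sup>+ y. ennreal (B * D) * (?P z * (bump k (fst y - fst z) * bump k (snd y - snd z)))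
          * (F1 (x - fst y) * F2 (x - snd y)) \<partial>lborel)
          = (\<integral>\<^sup>+ y. (ennreal (B * D) * ?P z) * (bump k (fst y - fst z) * bump k (snd y - snd z) * (F1 (x - fst y) * F2 (x - snd y))) \<partial>lborel)"
        by (simp add: mult.assoc)
      also have "\<dots> = (ennreal (B * D) * ?P z) * (smooth k F1 (x - fst z) * smooth k F2 (x - snd z))"
        by (subst nn_integral_cmult) (auto simp: nn_integral_bump_product)
      finally show "(\<integral>\<^sup>+ y. ennreal (B * D) * (?P z * (bump k (fst y - fst z) * bump k (snd y - snd z)))
          * (F1 (x - fst y) * F2 (x - snd y)) \<partial>lborel)
          = ennreal (B * D) * (?P z * (smooth k F1 (x - fst z) * smooth k F2 (x - snd z)))"
        by (simp add: mult.assoc)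
    qed
    also have "\<dots> = ennreal (B * D) * form ?P (smooth k F1) (smooth k F2) x"
      unfolding form_def by (rule nn_integral_cmult) measurable
    finally show "ennreal (norm (L_op \<Psi> \<Omega> \<mu> \<gamma> f1 f2 x)) \<le> ennreal (B * D) *
        form (polar_kernel H \<gamma>) (smooth (\<gamma> - \<mu>) (\<lambda>t. ennreal (norm (f1 t)))) (smooth (\<gamma> - \<mu>) (\<lambda>t. ennreal (norm (f2 t)))) x"
      unfolding k_def F1_def[abs_def] F2_def[abs_def] .
  qed
qed

section \<open>Homogeneity and the final constants\<close>

lemma smooth_cmult:
  assumes [measurable]: "f \<in> borel_measurable borel"
  shows "smooth k (\<lambda>t. c * f t) u = c * smooth k f u"
  unfolding smooth_def by (subst nn_integral_cmult[symmetric]) (auto simp: mult.left_commute)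

lemma form_scale:
  assumes [measurable]: "K \<in> borel_measurable borel" "g1 \<in> borel_measurable borel" "g2 \<in> borel_measurable borel"
  shows "form (\<lambda>z. c * K z) (\<lambda>t. p * g1 t) (\<lambda>t. q * g2 t) x = c * (p * (q * form K g1 g2 x))"
proof -
  have "form (\<lambda>z. c * K z) (\<lambda>t. p * g1 t) (\<lambda>t. q * g2 t) x
      = (\<integral>\<^sup>+ z. (c * (p * q)) * (K z * (g1 (x - fst z) * g2 (x - snd z))) \<partial>lborel)"
    unfolding form_def by (intro nn_integral_cong) (simp add: mult_ac)
  also have "\<dots> = (c * (p * q)) * form K g1 g2 x"
    unfolding form_def by (rule nn_integral_cmult) measurable
  finally show ?thesis by (simp add: mult.assoc)
qed

text \<open>Positive upper bounds \<open>B\<close>, \<open>a\<close>, \<open>b\<close> replace the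
  norms themselves, so that kernel and functions can be divided by them even when a norm
  vanishes.\<close>

lemma weak_type_L_op:
  assumes "schwartz \<Psi>"
    and "closure {\<xi>. fourier \<Psi> \<xi> \<noteq> 0} \<subseteq> {\<xi>. 1 / 2 \<le> norm \<xi> \<and> norm \<xi> \<le> 2}"
  obtains C where "C > 0"
    "\<And>\<Omega> m f1 f2 B a b. \<Omega> \<in> L1_u1 \<Longrightarrow> schwartz f1 \<Longrightarrow> schwartz f2 \<Longrightarrow> B > 0 \<Longrightarrow> a > 0 \<Longrightarrow> b > 0 \<Longrightarrow>
      L1_u1_norm \<Omega> \<le> ennreal B \<Longrightarrow> L1_norm f1 \<le> ennreal a \<Longrightarrow> L1_norm f2 \<le> ennreal b \<Longrightarrow>
      weak_L_half_norm (\<lambda>x. SUP \<gamma>. ennreal (norm (L_op \<Psi> \<Omega> (int m) \<gamma> f1 f2 x))) \<le> ennreal (C * (real m + 2)\<^sup>2 * B * a * b)"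
proof -
  obtain C where C: "C > 0" and L: "\<And>\<Omega> H \<mu> \<gamma> f1 f2 x. H \<in> borel_measurable borel \<Longrightarrow> (\<And>z. norm z = 1 \<Longrightarrow> ennreal (norm (\<Omega> z)) \<le> H z) \<Longrightarrow>
      schwartz f1 \<Longrightarrow> schwartz f2 \<Longrightarrow>
      ennreal (norm (L_op \<Psi> \<Omega> \<mu> \<gamma> f1 f2 x)) \<le> ennreal C *
        form (polar_kernel H \<gamma>) (smooth (\<gamma> - \<mu>) (\<lambda>t. ennreal (norm (f1 t)))) (smooth (\<gamma> - \<mu>) (\<lambda>t. ennreal (norm (f2 t)))) x"
    using norm_L_op_le[OF assms] by blast
  show thesis
  proof (rule that[of "2000\<^sup>2 * C"])
    show "2000\<^sup>2 * C > 0" using C by simp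
  next
    fix \<Omega> m f1 f2 and B a b :: real
    assume \<Omega>: "\<Omega> \<in> L1_u1" and f: "schwartz f1" "schwartz f2" and pos: "B > 0" "a > 0" "b > 0"
      and norms: "L1_u1_norm \<Omega> \<le> ennreal B" "L1_norm f1 \<le> ennreal a" "L1_norm f2 \<le> ennreal b"
    have [measurable]: "f1 \<in> borel_measurable borel" "f2 \<in> borel_measurable borel"
      using f by (auto intro: schwartz_measurable)
    obtain H where H [measurable]: "H \<in> borel_measurable borel"
      and H_ge: "\<And>z. norm z = 1 \<Longrightarrow> ennreal (norm (\<Omega> z)) \<le> H z"
      and H_int: "(\<integral>\<^sup>+ t. H (cos t, sin t) * u1 (cos t, sin t) * indicator {0..<2 * pi} t \<partial>lborel) = L1_u1_norm \<Omega>"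
      using borel_majorant_arc_length[of \<Omega>] \<Omega> unfolding L1_u1_def by blast
    define K where "K \<gamma> z = ennreal (1 / B) * polar_kernel H \<gamma> z" for \<gamma> z
    have K: "annular_kernel (K \<gamma>) \<gamma>" for \<gamma>
      unfolding K_def[abs_def] using norms(1) pos(1) by (intro annular_kernel_polar) (auto simp: H_int)
    define F1 where "F1 t = ennreal (norm (f1 t))" for t
    define F2 where "F2 t = ennreal (norm (f2 t))" for t
    have [measurable]: "F1 \<in> borel_measurable borel" "F2 \<in> borel_measurable borel"
      unfolding F1_def[abs_def] F2_def[abs_def] by measurable
    define g1 where "g1 t = ennreal (1 / a) * F1 t" for t
    define g2 where "g2 t = ennreal (1 / b) * F2 t" for t
    have [measurable]: "g1 \<in> borel_measurable borel" "g2 \<in> borel_measurable borel"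
      unfolding g1_def[abs_def] g2_def[abs_def] by measurable
    have g1: "(\<integral>\<^sup>+ t. g1 t \<partial>lborel) \<le> 1"
    proof -
      have "(\<integral>\<^sup>+ t. g1 t \<partial>lborel) = ennreal (1 / a) * L1_norm f1"
        unfolding g1_def F1_def L1_norm_def nn_integral_completion by (rule nn_integral_cmult) measurable
      also have "\<dots> \<le> ennreal (1 / a) * ennreal a" by (intro mult_left_mono norms) auto
      also have "\<dots> = 1" using pos by (simp flip: ennreal_mult)
      finally show ?thesis .
    qed
    have g2: "(\<integral>\<^sup>+ t. g2 t \<partial>lborel) \<le> 1"
    proof -
      have "(\<integral>\<^sup>+ t. g2 t \<partial>lborel) = ennreal (1 / b) * L1_norm f2"
        unfolding g2_def F2_def L1_norm_def nn_integral_completion by (rule nn_integral_cmult) measurable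
      also have "\<dots> \<le> ennreal (1 / b) * ennreal b" by (intro mult_left_mono norms) auto
      also have "\<dots> = 1" using pos by (simp flip: ennreal_mult)
      finally show ?thesis .
    qed
    \<comment> \<open>\<open>M\<close> collects all normalising factors: the operator exceeds
      \<open>l\<close> only where the normalised form exceeds \<open>l / M\<close>.\<close>
    define M where "M = C * B * a * b"
    have M: "M > 0" using C pos by (simp add: M_def)
    have L_le: "ennreal (norm (L_op \<Psi> \<Omega> (int m) \<gamma> f1 f2 x)) \<le> ennreal M * lacunary_form K m \<gamma> g1 g2 x" for \<gamma> x
    proof -
      define I where "I = form (polar_kernel H \<gamma>) (smooth (\<gamma> - int m) F1) (smooth (\<gamma> - int m) F2) x"
      have "lacunary_form K m \<gamma> g1 g2 x = form (\<lambda>z. ennreal (1 / B) * polar_kernel H \<gamma> z)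
          (\<lambda>u. ennreal (1 / a) * smooth (\<gamma> - int m) F1 u) (\<lambda>u. ennreal (1 / b) * smooth (\<gamma> - int m) F2 u) x"
      proof -
        have "smooth k g1 = (\<lambda>u. ennreal (1 / a) * smooth k F1 u)" "smooth k g2 = (\<lambda>u. ennreal (1 / b) * smooth k F2 u)" for k
          unfolding g1_def[abs_def] g2_def[abs_def] by (rule ext, rule smooth_cmult, measurable)+
        then show ?thesis unfolding lacunary_form_def K_def[abs_def] by (simp only:)
      qed
      also have "\<dots> = ennreal (1 / B) * (ennreal (1 / a) * (ennreal (1 / b) * I))"
        unfolding I_def by (rule form_scale) measurable
      finally have e: "lacunary_form K m \<gamma> g1 g2 x = ennreal (1 / B) * (ennreal (1 / a) * (ennreal (1 / b) * I))" .
      have "ennreal M * lacunary_form K m \<gamma> g1 g2 x = ennreal (M * (1 / B) * (1 / a) * (1 / b)) * I"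
      proof -
        have "ennreal r * (ennreal p * (ennreal q * (ennreal s * I))) = ennreal (r * p * q * s) * I"
          if "r \<ge> 0" "p \<ge> 0" "q \<ge> 0" "s \<ge> 0" for r p q s
          using that by (simp add: ennreal_mult mult.assoc)
        then show ?thesis unfolding e using M pos by simp
      qed
      also have "M * (1 / B) * (1 / a) * (1 / b) = C" using pos by (simp add: M_def)
      finally have "ennreal M * lacunary_form K m \<gamma> g1 g2 x = ennreal C * I" .
      moreover have "ennreal (norm (L_op \<Psi> \<Omega> (int m) \<gamma> f1 f2 x)) \<le> ennreal C * I"
        unfolding I_def F1_def[abs_def] F2_def[abs_def] by (rule L[OF H H_ge f])
      ultimately show ?thesis by simp
    qed
    show "weak_L_half_norm (\<lambda>x. SUP \<gamma>. ennreal (norm (L_op \<Psi> \<Omega> (int m) \<gamma> f1 f2 x)))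
        \<le> ennreal (2000\<^sup>2 * C * (real m + 2)\<^sup>2 * B * a * b)"
      unfolding weak_L_half_norm_def
    proof (rule SUP_least)
      fix l :: real assume "l \<in> {0<..}"
      then have l: "l > 0" by simp
      let ?S = "{x. \<exists>\<gamma>. lacunary_form K m \<gamma> g1 g2 x > ennreal (l / M)}"
      have [measurable]: "K \<gamma> \<in> borel_measurable borel" for \<gamma> unfolding K_def[abs_def] by measurable
      have S: "?S \<in> sets borel"
      proof -
        have "{x \<in> space borel. \<exists>\<gamma>. lacunary_form K m \<gamma> g1 g2 x > ennreal (l / M)} \<in> sets borel" by measurable
        then show ?thesis by simp
      qed
      have sub: "{x. (SUP \<gamma>. ennreal (norm (L_op \<Psi> \<Omega> (int m) \<gamma> f1 f2 x))) > ennreal l} \<subseteq> ?S"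
      proof
        fix x assume "x \<in> {x. (SUP \<gamma>. ennreal (norm (L_op \<Psi> \<Omega> (int m) \<gamma> f1 f2 x))) > ennreal l}"
        then obtain \<gamma> where "ennreal (norm (L_op \<Psi> \<Omega> (int m) \<gamma> f1 f2 x)) > ennreal l"
          by (auto simp: less_SUP_iff)
        then have gt: "ennreal l < ennreal M * lacunary_form K m \<gamma> g1 g2 x"
          using L_le by (rule less_le_trans)
        have "ennreal (l / M) < lacunary_form K m \<gamma> g1 g2 x"
        proof (rule ccontr)
          assume "\<not> ?thesis"
          then have "ennreal M * lacunary_form K m \<gamma> g1 g2 x \<le> ennreal M * ennreal (l / M)"
            by (intro mult_left_mono) auto
          also have "\<dots> = ennreal l" using M l by (simp flip: ennreal_mult)
          finally show False using gt by simp
        qed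
        then show "x \<in> ?S" by auto
      qed
      \<comment> \<open>Monotonicity asks for measurability of the larger set only, so the Borel set
        \<open>?S\<close> stands in for the level set of the supremum.\<close>
      have "emeasure lebesgue {x. (SUP \<gamma>. ennreal (norm (L_op \<Psi> \<Omega> (int m) \<gamma> f1 f2 x))) > ennreal l} \<le> emeasure lebesgue ?S"
        using S by (intro emeasure_mono[OF sub]) auto
      also have "\<dots> = emeasure lborel ?S" using S by simp
      also have "\<dots> \<le> ennreal (2000 * (real m + 2) / sqrt (l / M))"
        using l M by (intro weak_type_normalized K g1 g2) auto
      finally have "ennreal l * (emeasure lebesgue {x. (SUP \<gamma>. ennreal (norm (L_op \<Psi> \<Omega> (int m) \<gamma> f1 f2 x))) > ennreal l})\<^sup>2
          \<le> ennreal l * (ennreal (2000 * (real m + 2) / sqrt (l / M)))\<^sup>2"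
        by (intro mult_left_mono power_mono) auto
      also have "\<dots> = ennreal (l * (2000 * (real m + 2) / sqrt (l / M))\<^sup>2)"
        using l M by (subst ennreal_power) (auto intro: ennreal_mult[symmetric])
      \<comment> \<open>The square in the quasi-norm cancels \<open>l\<close> against the root in
        the measure bound and turns \<open>m + 2\<close> into its square.\<close>
      also have "l * (2000 * (real m + 2) / sqrt (l / M))\<^sup>2 = 2000\<^sup>2 * C * (real m + 2)\<^sup>2 * B * a * b"
      proof -
        have "(2000 * (real m + 2) / sqrt (l / M))\<^sup>2 = (2000 * (real m + 2))\<^sup>2 / (l / M)"
          using l M by (simp only: power_divide real_sqrt_pow2_iff real_sqrt_pow2 divide_nonneg_nonneg less_imp_le)
        then have "l * (2000 * (real m + 2) / sqrt (l / M))\<^sup>2 = (2000 * (real m + 2))\<^sup>2 * M"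
          using l M by simp
        then show ?thesis by (simp only: power_mult_distrib M_def mult_ac)
      qed
      finally show "ennreal l * (emeasure lebesgue {x. (SUP \<gamma>. ennreal (norm (L_op \<Psi> \<Omega> (int m) \<gamma> f1 f2 x))) > ennreal l})\<^sup>2
        \<le> ennreal (2000\<^sup>2 * C * (real m + 2)\<^sup>2 * B * a * b)" .
    qed
  qed
qed

text \<open>This is where the polynomial loss is traded for \<open>2 powr (\<epsilon> * m)\<close>,
  with a constant that blows up as \<open>\<epsilon>\<close> tends to 0.\<close>

lemma square_le_exponential:
  fixes \<epsilon> :: real
  assumes e: "\<epsilon> > 0"
  shows "(real m + 2)\<^sup>2 \<le> (2 + 2 / (\<epsilon> * ln 2))\<^sup>2 * 2 powr (\<epsilon> * real m)"
proof -
  let ?D = "2 + 2 / (\<epsilon> * ln 2)" and ?y = "\<epsilon> * real m * ln 2"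
  have p: "\<epsilon> * ln 2 > 0" using e by simp
  \<comment> \<open>The two summands of \<open>?D\<close> are chosen to reproduce \<open>2\<close>
    and, through \<open>2 / (\<epsilon> * ln 2) * (?y / 2) = m\<close>, the term \<open>m\<close>;
    halving \<open>?y\<close> anticipates the squaring.\<close>
  have "real m + 2 \<le> ?D * (1 + ?y / 2)"
  proof -
    have "?D * (1 + ?y / 2) = 2 + ?y + 2 / (\<epsilon> * ln 2) + real m"
    proof -
      have "(2 + 2 / q) * (1 + q * r / 2) = 2 + q * r + 2 / q + r" if "q > 0" for q r :: real
        using that by (simp add: field_simps)
      from this[OF p, of "real m"] show ?thesis by (simp only: mult_ac)
    qed
    moreover have "?y \<ge> 0" "2 / (\<epsilon> * ln 2) \<ge> 0" using p e by simp_all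
    ultimately show ?thesis by linarith
  qed
  also have "\<dots> \<le> ?D * exp (?y / 2)"
    using p by (intro mult_left_mono exp_ge_add_one_self) auto
  finally have "(real m + 2)\<^sup>2 \<le> (?D * exp (?y / 2))\<^sup>2" by (intro power_mono) auto
  also have "\<dots> = ?D\<^sup>2 * exp ?y"
    by (simp add: power_mult_distrib flip: exp_double)
  also have "exp ?y = 2 powr (\<epsilon> * real m)" by (simp add: powr_def)
  finally show ?thesis .
qed

theorem proposition6:
  fixes \<Psi> :: "real \<times> real \<Rightarrow> complex" and C0 \<epsilon> :: real
  assumes "C0 > 1"
    and "schwartz \<Psi>"
    and "closure {\<xi>. fourier \<Psi> \<xi> \<noteq> 0} \<subseteq> {\<xi>. 1 / 2 \<le> norm \<xi> \<and> norm \<xi> \<le> 2}"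
    and "\<And>\<xi>. \<xi> \<noteq> 0 \<Longrightarrow>
      ((\<lambda>k::int. fourier (dyadic_dilation \<Psi> k) \<xi>) has_sum 1) UNIV"
    and "0 < \<epsilon>" and "\<epsilon> < 1"
  shows "\<exists>C::real. C > 0 \<and>
    (\<forall>(\<mu>::int) (\<Omega> :: real \<times> real \<Rightarrow> complex) (f1 :: real \<Rightarrow> complex) (f2 :: real \<Rightarrow> complex).
      2 powi (\<mu> - 10) > C0 \<longrightarrow> \<Omega> \<in> L1_u1 \<longrightarrow> (LINT \<theta>|arc_length. \<Omega> \<theta>) = 0 \<longrightarrow>
      schwartz f1 \<longrightarrow> schwartz f2 \<longrightarrow>
      weak_L_half_norm (\<lambda>x. SUP \<gamma>::int. ennreal (norm (L_op \<Psi> \<Omega> \<mu> \<gamma> f1 f2 x)))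
        \<le> ennreal (C * 2 powr (\<epsilon> * of_int \<mu>)) * L1_u1_norm \<Omega> * L1_norm f1 * L1_norm f2)"
proof -
  obtain C where C: "C > 0" and weak: "\<And>\<Omega> m f1 f2 B a b. \<Omega> \<in> L1_u1 \<Longrightarrow> schwartz f1 \<Longrightarrow> schwartz f2 \<Longrightarrow> B > 0 \<Longrightarrow> a > 0 \<Longrightarrow> b > 0 \<Longrightarrow>
      L1_u1_norm \<Omega> \<le> ennreal B \<Longrightarrow> L1_norm f1 \<le> ennreal a \<Longrightarrow> L1_norm f2 \<le> ennreal b \<Longrightarrow>
      weak_L_half_norm (\<lambda>x. SUP \<gamma>. ennreal (norm (L_op \<Psi> \<Omega> (int m) \<gamma> f1 f2 x))) \<le> ennreal (C * (real m + 2)\<^sup>2 * B * a * b)"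
    using weak_type_L_op[OF assms(2,3)] by blast
  define D where "D = (2 + 2 / (\<epsilon> * ln 2))\<^sup>2"
  have "2 + 2 / (\<epsilon> * ln 2) > 0" using \<open>0 < \<epsilon>\<close> by (intro add_pos_nonneg) auto
  then have D: "D > 0" unfolding D_def by (rule zero_less_power)
  show ?thesis
  proof (intro exI[of _ "C * D"] conjI allI impI)
    show "C * D > 0" using C D by simp
  next
    fix \<mu> :: int and \<Omega> :: "real \<times> real \<Rightarrow> complex" and f1 f2 :: "real \<Rightarrow> complex"
    assume \<mu>: "2 powi (\<mu> - 10) > C0" and \<Omega>: "\<Omega> \<in> L1_u1" and f: "schwartz f1" "schwartz f2"
    \<comment> \<open>The threshold on \<open>\<mu>\<close> enters only here; a natural number of
      scales is needed for the count of heavy scales.\<close>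
    have "\<mu> \<ge> 0"
    proof (rule ccontr)
      assume "\<not> \<mu> \<ge> 0"
      then have "(2::real) powi (\<mu> - 10) \<le> 2 powi 0" by (intro power_int_increasing) auto
      then show False using \<mu> \<open>C0 > 1\<close> by simp
    qed
    then obtain m where m: "\<mu> = int m" using zero_le_imp_eq_int by blast
    let ?N = "weak_L_half_norm (\<lambda>x. SUP \<gamma>::int. ennreal (norm (L_op \<Psi> \<Omega> \<mu> \<gamma> f1 f2 x)))"
    define B where "B = enn2real (L1_u1_norm \<Omega>)"
    define a where "a = enn2real (L1_norm f1)"
    define b where "b = enn2real (L1_norm f2)"
    have fin: "L1_u1_norm \<Omega> = ennreal B" "L1_norm f1 = ennreal a" "L1_norm f2 = ennreal b"
      using \<Omega> schwartz_L1_norm_finite[OF f(1)] schwartz_L1_norm_finite[OF f(2)]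
      by (simp_all add: B_def a_def b_def L1_u1_def)
    have nn: "B \<ge> 0" "a \<ge> 0" "b \<ge> 0" by (simp_all add: B_def a_def b_def)
    \<comment> \<open>A norm may be zero, so the estimate is applied with each norm increased by
      \<open>\<delta> > 0\<close>, and \<open>\<delta>\<close> then tends to 0.\<close>
    have "?N \<le> ennreal (C * (real m + 2)\<^sup>2 * B * a * b)"
    proof (rule tendsto_lowerbound)
      show "((\<lambda>\<delta>. ennreal (C * (real m + 2)\<^sup>2 * (B + \<delta>) * (a + \<delta>) * (b + \<delta>))) \<longlongrightarrow>
          ennreal (C * (real m + 2)\<^sup>2 * B * a * b)) (at_right 0)"
        by (rule tendsto_ennrealI) (auto intro!: tendsto_eq_intros)
      show "\<forall>\<^sub>F \<delta> in at_right 0. ?N \<le> ennreal (C * (real m + 2)\<^sup>2 * (B + \<delta>) * (a + \<delta>) * (b + \<delta>))"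
        unfolding eventually_at_right_field m
        by (intro exI[of _ 1] conjI allI impI weak \<Omega> f) (use nn in \<open>auto simp: fin intro!: ennreal_leI add_nonneg_pos\<close>)
    qed simp
    also have "\<dots> \<le> ennreal (C * (D * 2 powr (\<epsilon> * real m)) * B * a * b)"
      using square_le_exponential[OF \<open>0 < \<epsilon>\<close>, of m] C nn
      by (intro ennreal_leI mult_right_mono mult_left_mono) (auto simp: D_def)
    also have "\<dots> = ennreal (C * D * 2 powr (\<epsilon> * of_int \<mu>)) * L1_u1_norm \<Omega> * L1_norm f1 * L1_norm f2"
      unfolding fin using C D nn by (simp add: m mult.assoc flip: ennreal_mult)
    finally show "?N \<le> ennreal (C * D * 2 powr (\<epsilon> * of_int \<mu>)) * L1_u1_norm \<Omega> * L1_norm f1 * L1_norm f2" .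
  qed
qed

end
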